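(* Let $(X,\Gamma)$ be a topological dynamical system, where $\Gamma$ is a nilpotent group such that for each $T\in\Gamma$ with $T\neq e_\Gamma$ the system $(X,T)$ is weakly mixing and minimal. Let $d,k\in\mathbb{N}$, let $T_1,\ldots,T_d\in\Gamma$, and let $p_{i,j}\in\mathcal{P}_0$ for $1\le i\le k$, $1\le j\le d$. For $i=1,\ldots,k$ and $n\in\mathbb{Z}$ put $$g_i(n)=T_1^{p_{i,1}(n)}\cdots T_d^{p_{i,d}(n)}.$$ Assume that $g_i(n)$ depends nontrivially on $n$ for each $i=1,\ldots,k$, and that $g_i(n)g_j(n)^{-1}$ depends nontrivially on $n$ for all $i\neq j$ in $\{1,\ldots,k\}$. Then there is a dense $G_\delta$ subset $X_0$ of $X$ such that for all $x\in X_0$ the set $$\{(g_1(n)x,\ldots,g_k(n)x): n\in\mathbb{Z}\}$$ is dense in $X^k$.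
   Context: A topological dynamical system $(X,\Gamma)$ consists of a compact metric space $X$ and a Hausdorff topological group $\Gamma$ with unit $e_\Gamma$ acting on $X$ by a continuous action map $\Gamma\times X\to X$. For $T\in\Gamma$ (or a homeomorphism $T$ of $X$), $(X,T)$ denotes the $\mathbb{Z}$-action on $X$ generated by $T$. A system is minimal if $X$ contains no proper non-empty closed invariant subset; it is transitive if every non-empty invariant open subset is dense; it is weakly mixing if the product system $X\times X$ (with the diagonal action) is transitive. $\mathcal{P}_0$ is the set of polynomials $p$ with rational coefficients taking integer values on the integers and with $p(0)=0$. A map $g:\mathbb{Z}\to\Gamma$ "depends nontrivially on $n$" if it is a nonconstant map. $\mathbb{N}$ is the set of positive integers. *)

theory Defs
  imports
    "HOL-Analysis.Analysis"
    "HOL-Algebra.Generated_Groups"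
    "HOL-Algebra.Group_Action"
    "HOL-Algebra.Elementary_Groups"
    "HOL-Computational_Algebra.Polynomial"
begin

section \<open>Nilpotent groups\<close>

primrec lower_central_series :: "('g, 'm) monoid_scheme \<Rightarrow> nat \<Rightarrow> 'g set" where
  "lower_central_series G 0 = carrier G"
| "lower_central_series G (Suc n) =
     generate G (\<Union>x \<in> lower_central_series G n. \<Union>y \<in> carrier G.
       {x \<otimes>\<^bsub>G\<^esub> y \<otimes>\<^bsub>G\<^esub> inv\<^bsub>G\<^esub> x \<otimes>\<^bsub>G\<^esub> inv\<^bsub>G\<^esub> y})"

definition nilpotent_group :: "('g, 'm) monoid_scheme \<Rightarrow> bool" where
  "nilpotent_group G \<longleftrightarrow> group G \<and> (\<exists>n. lower_central_series G n = {\<one>\<^bsub>G\<^esub>})"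


section \<open>Topological dynamical systems\<close>

locale hausdorff_topological_group = group G for G (structure) +
  fixes TG :: "'a topology"
  assumes topspace_group: "topspace TG = carrier G"
    and hausdorff_group: "Hausdorff_space TG"
    and continuous_mult: "continuous_map (prod_topology TG TG) TG (\<lambda>(g, h). g \<otimes> h)"
    and continuous_inv: "continuous_map TG TG (\<lambda>g. inv g)"

locale topological_dynamical_system =
  Metric_space M dX + hausdorff_topological_group G TG + group_action G M \<phi>
  for M :: "'x set" and dX :: "'x \<Rightarrow> 'x \<Rightarrow> real"
    and G :: "('g, 'm) monoid_scheme" (structure) and TG :: "'g topology"
    and \<phi> :: "'g \<Rightarrow> 'x \<Rightarrow> 'x" +
  assumes compact_phase_space: "compact_space mtopology"
    and continuous_action: "continuous_map (prod_topology TG mtopology) mtopology (\<lambda>(g, x). \<phi> g x)"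

text \<open>
  The notions below concern the action of a group on a topological space \<open>X\<close>; the group
  topology plays no role in them. Since \<open>G\<close> is a group, \<open>\<phi> g ` A \<subseteq> A\<close> for all \<open>g\<close> is the same
  as \<open>\<phi> g ` A = A\<close> for all \<open>g\<close>.
\<close>

definition invariant_set :: "('g, 'm) monoid_scheme \<Rightarrow> ('g \<Rightarrow> 'x \<Rightarrow> 'x) \<Rightarrow> 'x set \<Rightarrow> bool" where
  "invariant_set G \<phi> A \<longleftrightarrow> (\<forall>g \<in> carrier G. \<phi> g ` A \<subseteq> A)"

definition minimal_system ::
    "'x topology \<Rightarrow> ('g, 'm) monoid_scheme \<Rightarrow> ('g \<Rightarrow> 'x \<Rightarrow> 'x) \<Rightarrow> bool" where
  "minimal_system X G \<phi> \<longleftrightarrow>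
     (\<forall>C. closedin X C \<and> C \<noteq> {} \<and> invariant_set G \<phi> C \<longrightarrow> C = topspace X)"

definition transitive_system ::
    "'x topology \<Rightarrow> ('g, 'm) monoid_scheme \<Rightarrow> ('g \<Rightarrow> 'x \<Rightarrow> 'x) \<Rightarrow> bool" where
  "transitive_system X G \<phi> \<longleftrightarrow>
     (\<forall>U. openin X U \<and> U \<noteq> {} \<and> invariant_set G \<phi> U \<longrightarrow> X closure_of U = topspace X)"

definition weakly_mixing_system ::
    "'x topology \<Rightarrow> ('g, 'm) monoid_scheme \<Rightarrow> ('g \<Rightarrow> 'x \<Rightarrow> 'x) \<Rightarrow> bool" where
  "weakly_mixing_system X G \<phi> \<longleftrightarrow>
     transitive_system (prod_topology X X) G (\<lambda>g (x, y). (\<phi> g x, \<phi> g y))"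

text \<open>The action of the integers generated by the group element \<open>T\<close>, to be used with \<open>integer_group\<close>.\<close>

definition generated_action ::
    "('g, 'm) monoid_scheme \<Rightarrow> ('g \<Rightarrow> 'x \<Rightarrow> 'x) \<Rightarrow> 'g \<Rightarrow> int \<Rightarrow> 'x \<Rightarrow> 'x" where
  "generated_action G \<phi> T n = \<phi> (T [^]\<^bsub>G\<^esub> n)"


section \<open>Integer-valued polynomials as exponents\<close>

definition integral_polys0 :: "rat poly set" where
  "integral_polys0 = {p. (\<forall>n::int. poly p (of_int n) \<in> \<int>) \<and> poly p 0 = 0}"

text \<open>On \<open>integral_polys0\<close> the floor only converts an integral rational value to type \<open>int\<close>.\<close>

definition int_value :: "rat poly \<Rightarrow> int \<Rightarrow> int" where
  "int_value p n = \<lfloor>poly p (of_int n)\<rfloor>"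

text \<open>The ordered product \<open>T 1 [^] q 1 n \<otimes> \<dots> \<otimes> T d [^] q d n\<close>.\<close>

definition poly_word ::
    "('g, 'm) monoid_scheme \<Rightarrow> nat \<Rightarrow> (nat \<Rightarrow> 'g) \<Rightarrow> (nat \<Rightarrow> rat poly) \<Rightarrow> int \<Rightarrow> 'g" where
  "poly_word G d T q n =
     foldr (\<lambda>j y. (T j [^]\<^bsub>G\<^esub> int_value (q j) n) \<otimes>\<^bsub>G\<^esub> y) [1..<Suc d] \<one>\<^bsub>G\<^esub>"

definition depends_nontrivially :: "(int \<Rightarrow> 'g) \<Rightarrow> bool" where
  "depends_nontrivially h \<longleftrightarrow> \<not> h constant_on UNIV"

end

theory Submission
  imports Defs "HOL-Library.Function_Algebras"
begin

text \<open>
  By a Baire category argument it suffices that for nonempty open \<open>U, V\<^sub>1, \<dots>, V\<^sub>k\<close> some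
  \<open>n\<close> and some \<open>z \<in> U\<close> satisfy \<open>g\<^sub>i(n) z \<in> V\<^sub>i\<close> for all \<open>i\<close>. This is proved by PET induction on
  the finite set of sequences \<open>g\<^sub>i\<close>, taken in a group \<open>P\<close> of polynomial sequences that carries a
  filtration on which taking differences acts trivially. Let \<open>S \<noteq> 1\<close> be central; by minimality
  finitely many translates \<open>S\<^sup>j U\<close> cover \<open>X\<close>. For suitable shifts \<open>k\<^sub>j\<close> and a simplest \<open>f\<close> among the
  \<open>g\<^sub>i\<close>, the sequences \<open>g\<^sub>i(k\<^sub>j)\<^sup>-\<^sup>1 g\<^sub>i(n + k\<^sub>j) f(n)\<^sup>-\<^sup>1\<close> form a simpler family, so the induction hypothesis
  gives \<open>n\<close> and \<open>y\<close> with \<open>g\<^sub>i(n + k\<^sub>j) S\<^sup>-\<^sup>j y \<in> V\<^sub>i\<close> for all \<open>i\<close> and \<open>j\<close>; choose \<open>j\<close> such that \<open>y \<in> S\<^sup>j U\<close>.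
  The sequences \<open>g\<^sub>i\<close> that are homomorphisms do not change under shifts; for these the shifts
  \<open>k\<^sub>j\<close> are chosen with the help of weak mixing, whose return times are thickly syndetic.
\<close>

section \<open>Polynomial sequences in a filtered group\<close>

lemmas group_word = add.assoc diff_conv_add_uminus minus_add

section \<open>Integer sequences of bounded degree, measured by iterated differences\<close>

primrec diff_degree_le :: "nat \<Rightarrow> (int \<Rightarrow> 'b::ab_group_add) \<Rightarrow> bool" where
  "diff_degree_le 0 q \<longleftrightarrow> (\<forall>m n. q m = q n)"
| "diff_degree_le (Suc r) q \<longleftrightarrow> (\<forall>h. diff_degree_le r (\<lambda>n. q (n + h) - q n))"

lemma diff_degree_le_const: "diff_degree_le r (\<lambda>_. c)"
  by (induction r arbitrary: c) auto

lemma diff_degree_le_add: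
  "diff_degree_le r f \<Longrightarrow> diff_degree_le r g \<Longrightarrow> diff_degree_le r (\<lambda>n. f n + g n)"
proof (induction r arbitrary: f g)
  case 0
  then show ?case by (simp only: diff_degree_le.simps) metis
next
  case (Suc r)
  show ?case unfolding diff_degree_le.simps
  proof
    fix h
    have "diff_degree_le r (\<lambda>n. (f (n + h) - f n) + (g (n + h) - g n))"
      using Suc by simp
    then show "diff_degree_le r (\<lambda>n. f (n + h) + g (n + h) - (f n + g n))" by (simp add: algebra_simps)
  qed
qed

lemma diff_degree_le_mult_left:
  "diff_degree_le r f \<Longrightarrow> diff_degree_le r (\<lambda>n. c * f n :: 'a::comm_ring_1)"
proof (induction r arbitrary: f)
  case 0
  then show ?case by (simp only: diff_degree_le.simps) metis
qed (auto simp flip: right_diff_distrib)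

lemma diff_degree_le_shift: "diff_degree_le r f \<Longrightarrow> diff_degree_le r (\<lambda>n. f (n + h))"
proof (induction r arbitrary: f)
  case (Suc r)
  show ?case unfolding diff_degree_le.simps
  proof
    fix k
    have "diff_degree_le r (\<lambda>n. f (n + k) - f n)" using Suc by simp
    from Suc.IH[OF this] show "diff_degree_le r (\<lambda>n. f (n + k + h) - f (n + h))"
      by (simp add: algebra_simps)
  qed
qed auto

text \<open>Discrete product rule: the difference of \<open>of_int n * f n\<close> is
  \<open>of_int n * (f (n + h) - f n) + of_int h * f (n + h)\<close>. The induction hypothesis
  covers the first term, and shifting keeps the degree in the second. This is the Horner step of
  \<open>diff_degree_le_poly\<close>.\<close>

lemma diff_degree_le_mult_argument:
  "diff_degree_le r f \<Longrightarrow> diff_degree_le (Suc r) (\<lambda>n. of_int n * f n :: 'a::comm_ring_1)"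
proof (induction r arbitrary: f)
  case 0
  then have "f n = f 0" for n by auto
  then have "(\<lambda>n. of_int n * f n) = (\<lambda>n. of_int n * f 0)" by metis
  then show ?case by (simp add: algebra_simps)
next
  case (Suc r)
  show ?case unfolding diff_degree_le.simps(2)[of "Suc r"]
  proof
    fix h
    have "diff_degree_le r (\<lambda>n. f (n + h) - f n)" using Suc.prems by simp
    then have "diff_degree_le (Suc r) (\<lambda>n. of_int n * (f (n + h) - f n))" by (rule Suc.IH)
    moreover have "diff_degree_le (Suc r) (\<lambda>n. of_int h * f (n + h))"
      using Suc.prems by (intro diff_degree_le_mult_left diff_degree_le_shift)
    ultimately have "diff_degree_le (Suc r) (\<lambda>n. of_int n * (f (n + h) - f n) + of_int h * f (n + h))"
      by (rule diff_degree_le_add)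
    then show "diff_degree_le (Suc r) (\<lambda>n. of_int (n + h) * f (n + h) - of_int n * f n)"
      by (simp add: algebra_simps del: diff_degree_le.simps)
  qed
qed

lemma diff_degree_le_poly: "diff_degree_le (degree p) (\<lambda>n. poly p (of_int n :: rat))"
proof (induction p)
  case 0
  then show ?case by simp
next
  case (pCons a p)
  show ?case
  proof (cases "p = 0")
    case True
    then show ?thesis by (simp add: diff_degree_le_const)
  next
    case False
    then have "diff_degree_le (Suc (degree p)) (\<lambda>n. a + of_int n * poly p (of_int n))"
      using pCons.IH by (intro diff_degree_le_add diff_degree_le_mult_argument) (rule diff_degree_le_const)
    then show ?thesis using False by simp
  qed
qed

lemma diff_degree_le_of_int:
  "diff_degree_le r (\<lambda>n. of_int (q n) :: 'a::ring_char_0) \<Longrightarrow> diff_degree_le r q"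
proof (induction r arbitrary: q)
  case (Suc r)
  then show ?case by (simp flip: of_int_diff)
qed auto

lemma diff_degree_le_int_value:
  assumes "p \<in> integral_polys0"
  shows "diff_degree_le (degree p) (int_value p)"
proof -
  have "of_int (int_value p n) = poly p (of_int n)" for n
    using assms by (auto simp: integral_polys0_def int_value_def elim!: Ints_cases)
  then show ?thesis using diff_degree_le_poly[of p] diff_degree_le_of_int[of "degree p" "int_value p", where 'a = rat]
    by simp
qed

section \<open>Shifts, additive sequences and a commutator identity\<close>

definition shift :: "int \<Rightarrow> (int \<Rightarrow> 'a) \<Rightarrow> int \<Rightarrow> 'a" where
  "shift h g n = g (n + h)"

text \<open>The left factor \<open>- g k\<close> makes the shifted sequence vanish at 0. On
  sequences vanishing at 0 this is an action of the integers by bijections.\<close>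

definition based_shift :: "int \<Rightarrow> (int \<Rightarrow> 'a::group_add) \<Rightarrow> int \<Rightarrow> 'a" where
  "based_shift k g n = - g k + g (n + k)"

lemma based_shift_zero: "g 0 = 0 \<Longrightarrow> based_shift 0 g = g"
  by (simp add: based_shift_def fun_eq_iff)

lemma based_shift_at_zero: "based_shift k g 0 = 0"
  by (simp add: based_shift_def)

lemma based_shift_based_shift: "based_shift a (based_shift b g) = based_shift (a + b) g"
  by (simp add: based_shift_def fun_eq_iff group_word del: add_uminus_conv_diff)

lemma based_shift_inj:
  assumes "g 0 = 0" "g' 0 = 0" "based_shift k g = based_shift k g'"
  shows "g = g'"
proof -
  have "based_shift (- k) (based_shift k g) = based_shift (- k) (based_shift k g')"
    by (simp only: assms)
  then show ?thesis using assms(1,2) by (simp add: based_shift_based_shift based_shift_zero)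
qed

definition additive_seq :: "(int \<Rightarrow> 'a::group_add) \<Rightarrow> bool" where
  "additive_seq g \<longleftrightarrow> (\<forall>m n. g (m + n) = g m + g n)"

lemma additive_seq_based_shift:
  assumes "additive_seq g" shows "based_shift k g = g"
proof
  fix n show "based_shift k g n = g n"
    using assms unfolding based_shift_def additive_seq_def
    by (metis add.commute minus_add_cancel)
qed

lemma additive_seq_diff:
  assumes "additive_seq \<theta>"
  shows "\<theta> m - \<theta> n = \<theta> (m - n)"
proof -
  have "\<theta> m = \<theta> (m - n) + \<theta> n"
    using assms unfolding additive_seq_def by (metis diff_add_cancel)
  then show ?thesis by simp
qed

lemma additive_seq_unique:
  assumes "additive_seq f" "additive_seq g" "f 1 = g 1"
  shows "f = g"
proof -
  have z: "f 0 = 0" "g 0 = 0"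
    using assms(1,2) unfolding additive_seq_def by (metis add.right_neutral add_left_imp_eq)+
  have nat: "f (int n) = g (int n)" for n
  proof (induction n)
    case (Suc n)
    then show ?case using assms unfolding additive_seq_def of_nat_Suc by metis
  qed (simp add: z)
  have "f (- int n) = g (- int n)" for n
  proof -
    have "f (- int n) + f (int n) = 0" "g (- int n) + g (int n) = 0"
      using assms(1,2) z unfolding additive_seq_def by (metis add.left_inverse)+
    then show ?thesis using nat[of n] by (metis add_right_imp_eq)
  qed
  then show ?thesis using nat by (metis ext int_cases2)
qed

text \<open>An identity in the free group, obtained by writing the shifted entries as
  \<open>a + f\<close> and \<open>b + g\<close>. Apart from \<open>- w\<close> and a conjugate of
  \<open>w\<close>, each factor is a commutator with entry \<open>a\<close> or \<open>b\<close>, or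
  a conjugate of one.\<close>

lemma shift_diff_comm:
  fixes f g :: "int \<Rightarrow> 'a::group_add"
  assumes "a = shift h f - f" "b = shift h g - g" "w = f + g - f - g"
  shows "shift h w - w =
    (a + (f + b - f - b) - a) + ((a + b) + w - (a + b)) + (a + shift h g - a - shift h g) - w"
proof -
  have f: "shift h f = a + f" and g: "shift h g = b + g" using assms by auto
  have "shift h w = shift h f + shift h g - shift h f - shift h g"
    unfolding assms by (simp add: shift_def fun_eq_iff)
  then show ?thesis unfolding f g unfolding assms(3)
    by (simp add: group_word del: add_uminus_conv_diff)
qed

text \<open>
  Groups are written additively but need not be commutative. The number \<open>E\<close> bounds the degrees of
  the exponents: a sequence \<open>\<theta> (q n)\<close> with \<open>q\<close> of degree \<open>r\<close> starts at level \<open>E - r\<close>.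
\<close>

locale group_filtration =
  fixes L :: "nat \<Rightarrow> 'a::group_add set" and E N :: nat
  assumes zero_L: "0 \<in> L s"
    and add_L: "x \<in> L s \<Longrightarrow> y \<in> L s \<Longrightarrow> x + y \<in> L s"
    and uminus_L: "x \<in> L s \<Longrightarrow> - x \<in> L s"
    and Suc_L: "L (Suc s) \<subseteq> L s"
    and comm_L: "x \<in> L i \<Longrightarrow> y \<in> L j \<Longrightarrow> x + y - x - y \<in> L (i + j)"
    and trivial_L: "L N = {0}"
begin

text \<open>Polynomial sequences are usually defined by requiring all iterated differences to lie in
  the matching levels of the filtration. Generating them instead makes closure under products and
  commutators automatic and leaves the behaviour of differences as the thing to prove.\<close>

inductive poly_seq :: "nat \<Rightarrow> (int \<Rightarrow> 'a) \<Rightarrow> bool" where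
  const: "c \<in> L s \<Longrightarrow> poly_seq s (\<lambda>_. c)"
| hom: "additive_seq \<theta> \<Longrightarrow> range \<theta> \<subseteq> L E \<Longrightarrow> diff_degree_le r q \<Longrightarrow> r + s \<le> E
    \<Longrightarrow> poly_seq s (\<lambda>n. \<theta> (q n))"
| add: "poly_seq s f \<Longrightarrow> poly_seq s g \<Longrightarrow> poly_seq s (f + g)"
| uminus: "poly_seq s f \<Longrightarrow> poly_seq s (- f)"
| comm: "poly_seq i f \<Longrightarrow> poly_seq j g \<Longrightarrow> poly_seq (i + j) (f + g - f - g)"
| mono: "poly_seq (Suc s) f \<Longrightarrow> poly_seq s f"

lemma antimono_L: "i \<le> j \<Longrightarrow> L j \<subseteq> L i"
  using lift_Suc_antimono_le[of L] Suc_L by blast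

lemma poly_seq_antimono: "poly_seq j f \<Longrightarrow> i \<le> j \<Longrightarrow> poly_seq i f"
  by (induction j) (auto simp: le_Suc_eq intro: mono)

lemma poly_seq_zero: "poly_seq s 0"
  using const[OF zero_L] by (simp add: zero_fun_def)

lemma poly_seq_diff: "poly_seq s f \<Longrightarrow> poly_seq s g \<Longrightarrow> poly_seq s (f - g)"
  using add[OF _ uminus, of s f g] by simp

lemma poly_seq_comm_le:
  assumes "poly_seq i f" "poly_seq j g" "s \<le> i + j"
  shows "poly_seq s (f + g - f - g)"
  using comm poly_seq_antimono assms by blast

text \<open>Each level is normal, because \<open>f + g - f\<close> is a commutator of level at least
  \<open>s\<close> followed by \<open>g\<close>.\<close>

lemma poly_seq_conj:
  assumes "poly_seq i f" "poly_seq s g"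
  shows "poly_seq s (f + g - f)"
proof -
  have "poly_seq s ((f + g - f - g) + g)"
    by (rule add[OF poly_seq_comm_le[OF assms] assms(2)]) simp
  then show ?thesis by simp
qed

lemma poly_seq_range: "poly_seq s f \<Longrightarrow> range f \<subseteq> L s"
proof (induction rule: poly_seq.induct)
  case (hom \<theta> r q s)
  then show ?case using antimono_L[of s E] by auto
next
  case (mono s f)
  then show ?case using Suc_L by blast
next
  case (comm i f j g)
  then show ?case using comm_L by (auto simp: plus_fun_def fun_diff_def image_subset_iff)
qed (auto intro: add_L uminus_L)

text \<open>
  The closure under commutators built into \<open>poly_seq\<close> makes this an induction along the
  generation of a sequence: the derivative of a sum, an inverse or a commutator is a product of
  derivatives and of commutators with derivatives.
\<close>

lemma poly_seq_shift_diff: "poly_seq s f \<Longrightarrow> poly_seq (Suc s) (shift h f - f)"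
proof (induction rule: poly_seq.induct)
  case (const c s)
  have "shift h (\<lambda>_. c) - (\<lambda>_. c) = 0" by (auto simp: shift_def)
  then show ?case using poly_seq_zero by metis
next
  case (hom \<theta> r q s)
  have eq: "shift h (\<lambda>n. \<theta> (q n)) - (\<lambda>n. \<theta> (q n)) = (\<lambda>n. \<theta> (q (n + h) - q n))"
    using additive_seq_diff[OF hom(1)] by (auto simp: shift_def)
  show ?case
  proof (cases r)
    case 0
    have "\<theta> 0 = 0" using hom(1) unfolding additive_seq_def by (metis add.right_neutral add_left_imp_eq)
    moreover have "q (n + h) = q n" for n using hom 0 by (metis diff_degree_le.simps(1))
    ultimately have "shift h (\<lambda>n. \<theta> (q n)) - (\<lambda>n. \<theta> (q n)) = 0" unfolding eq by (auto simp: fun_eq_iff)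
    then show ?thesis using poly_seq_zero by metis
  next
    case (Suc r')
    then show ?thesis unfolding eq using hom by (intro poly_seq.hom[where r = r']) auto
  qed
next
  case (add s f g)
  let ?a = "shift h f - f" and ?b = "shift h g - g"
  have "shift h (f + g) = shift h f + shift h g" by (auto simp: shift_def)
  then have "shift h (f + g) - (f + g) = ?a + (f + ?b - f)"
    by (simp add: group_word del: add_uminus_conv_diff)
  then show ?case using poly_seq.add[OF add.IH(1) poly_seq_conj[OF add.hyps(1) add.IH(2)]] by metis
next
  case (uminus s f)
  let ?a = "shift h f - f"
  have "shift h (- f) = - shift h f" by (auto simp: shift_def)
  then have "shift h (- f) - (- f) = - f + (- ?a) - (- f)"
    by (simp add: group_word del: add_uminus_conv_diff)
  then show ?case
    using poly_seq_conj[OF poly_seq.uminus[OF uminus.hyps] poly_seq.uminus[OF uminus.IH]] by metis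
next
  case (comm i f j g)
  define a b w where "a = shift h f - f" and "b = shift h g - g" and "w = f + g - f - g"
  have a: "poly_seq (Suc i) a" and b: "poly_seq (Suc j) b"
    unfolding a_def b_def by (fact comm.IH)+
  have w: "poly_seq (i + j) w" unfolding w_def by (rule poly_seq.comm[OF comm.hyps])
  have sg: "shift h g = b + g" unfolding b_def by simp
  then have g': "poly_seq j (shift h g)" using poly_seq.add[OF mono[OF b] comm.hyps(2)] by simp
  have X: "poly_seq (Suc (i + j)) (a + (f + b - f - b) - a)"
    using poly_seq_conj[OF a] poly_seq.comm[OF comm(1) b] by simp
  have Y: "poly_seq (Suc (i + j)) (a + shift h g - a - shift h g)"
    using poly_seq.comm[OF a g'] by simp
  have ab: "poly_seq 1 (a + b)"
    using a b by (intro poly_seq.add) (auto intro: poly_seq_antimono)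
  have Z: "poly_seq (Suc (i + j)) ((a + b) + w - (a + b) - w)"
    using poly_seq.comm[OF ab w] by simp
  \<comment> \<open>Moving \<open>- w\<close> to the left turns the conjugate of \<open>w\<close> by
    \<open>a + b\<close> into the commutator of \<open>a + b\<close> with \<open>w\<close>, which
    gains a level; in exchange the last factor is conjugated by \<open>w\<close>.\<close>
  have eq: "shift h w - w = (a + (f + b - f - b) - a) + ((a + b) + w - (a + b) - w)
      + (w + (a + shift h g - a - shift h g) - w)"
    unfolding shift_diff_comm[OF a_def b_def w_def] by (simp add: group_word del: add_uminus_conv_diff)
  show ?case unfolding w_def[symmetric] eq
    by (intro poly_seq.add X Z poly_seq_conj[OF w Y])
next
  case (mono s f)
  then show ?case by (auto intro: poly_seq.mono)
qed

lemma poly_seq_trivial: "poly_seq s f \<Longrightarrow> N \<le> s \<Longrightarrow> f = 0"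
  using poly_seq_range[of s f] antimono_L[of N s] trivial_L by fastforce

lemma poly_seq_shift:
  assumes "poly_seq s f" shows "poly_seq s (shift h f)"
proof -
  have "poly_seq s ((shift h f - f) + f)"
    using assms poly_seq_shift_diff by (intro add) (auto intro: mono)
  then show ?thesis by simp
qed

lemma poly_seq_const_value: "poly_seq s f \<Longrightarrow> poly_seq s (\<lambda>_. f n)"
  using poly_seq_range[of s f] by (intro const) auto

lemma based_shift_eq: "based_shift k g = - (\<lambda>_. g k) + shift k g"
  by (auto simp: based_shift_def shift_def)

lemma poly_seq_based_shift: "poly_seq s g \<Longrightarrow> poly_seq s (based_shift k g)"
  unfolding based_shift_eq using poly_seq_shift poly_seq_const_value by (intro add uminus) auto

text \<open>The difference equals \<open>shift k g - g\<close> corrected by its value at 0. Hence a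
  based shift alters a sequence only modulo the next level, which is why shifting preserves levels
  and cosets in the PET induction.\<close>

lemma poly_seq_based_shift_diff:
  assumes "poly_seq s g" "g 0 = 0"
  shows "poly_seq (Suc s) (based_shift k g - g)"
proof -
  let ?u = "shift k g - g"
  have u: "poly_seq (Suc s) ?u" using assms poly_seq_shift_diff by auto
  have "?u 0 = g k" using assms(2) by (simp add: shift_def)
  then have "based_shift k g - g = - (\<lambda>_. ?u 0) + ?u"
    unfolding based_shift_eq by (simp add: add_diff_eq)
  moreover have "poly_seq (Suc s) (- (\<lambda>_. ?u 0) + ?u)"
    using u poly_seq_const_value[OF u] by (intro add uminus) auto
  ultimately show ?thesis by simp
qed

end

text \<open>The term \<open>((+) x ^^ m) 0\<close> is the \<open>m\<close>-fold multiple of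
  \<open>x\<close>.\<close>

locale torsion_free_filtration = group_filtration L E N for L :: "nat \<Rightarrow> 'a::group_add set" and E N +
  assumes torsion_free: "x \<in> L 0 \<Longrightarrow> m > 0 \<Longrightarrow> ((+) x ^^ m) 0 = 0 \<Longrightarrow> x = 0"
begin

text \<open>Induction on the number of levels left. The difference \<open>shift n f - f\<close>
  inherits the period and lies one level higher, so it is a constant \<open>c\<close>. Going
  \<open>m\<close> times from 0 in steps of \<open>n\<close> adds the \<open>m\<close>-fold multiple
  of \<open>c\<close>, while periodicity brings \<open>f\<close> back to \<open>f 0\<close>;
  torsion-freeness gives \<open>c = 0\<close>.\<close>

lemma periodic_poly_seq_const:
  assumes "poly_seq s f" "m > 0" "\<And>n. f (n + int m) = f n"
  shows "f n = f 0"
  using assms(1,3)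
proof (induction "N - s" arbitrary: s f n)
  case 0
  then show ?case using poly_seq_trivial[of s f] by auto
next
  case (Suc x)
  define c where "c = f n - f 0"
  have d: "shift n f - f = (\<lambda>_. c)"
  proof
    fix j
    have per: "(shift n f - f) (i + int m) = (shift n f - f) i" for i
      using Suc.prems(2)[of "i + n"] Suc.prems(2)[of i] by (simp add: shift_def algebra_simps)
    have "(shift n f - f) j = (shift n f - f) 0"
      by (rule Suc.hyps(1)[OF _ poly_seq_shift_diff[OF Suc.prems(1)] per]) (use Suc.hyps(2) in simp)
    then show "(shift n f - f) j = c" by (simp add: shift_def c_def)
  qed
  have step: "f (j + n) = c + f j" for j
    using fun_cong[OF d, of j] by (simp add: shift_def diff_eq_eq)
  have multiple: "f (int i * n) = ((+) c ^^ i) 0 + f 0" for i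
  proof (induction i)
    case (Suc i)
    then show ?case using step[of "int i * n"] by (simp add: algebra_simps)
  qed auto
  have "f (int m * int i) = f 0" "f (int m * (- int i)) = f 0" for i
  proof -
    show "f (int m * int i) = f 0"
    proof (induction i)
      case (Suc i)
      then show ?case using Suc.prems Suc(1) assms \<open>\<And>n. f (n + int m) = f n\<close>
        by (metis add.commute distrib_left mult.right_neutral of_nat_Suc)
    qed auto
    show "f (int m * (- int i)) = f 0"
    proof (induction i)
      case (Suc i)
      have "int m * (- int (Suc i)) + int m = int m * (- int i)" by (simp add: algebra_simps)
      then show ?case using Suc \<open>\<And>n. f (n + int m) = f n\<close> by metis
    qed auto
  qed
  then have "f (int m * n) = f 0"
    by (metis int_cases2)
  with multiple[of m] have "0 + f 0 = ((+) c ^^ m) 0 + f 0" by simp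
  then have "((+) c ^^ m) 0 = 0" by (simp only: add_right_cancel)
  moreover have "c \<in> L 0"
  proof -
    have "poly_seq 0 (f - (\<lambda>_. f 0))"
      using poly_seq_antimono[OF Suc.prems(1)] poly_seq_const_value by (intro poly_seq_diff) auto
    from poly_seq_range[OF this] show ?thesis unfolding c_def by auto
  qed
  ultimately have "c = 0" using torsion_free assms(2) by blast
  then show ?case by (simp add: c_def)
qed

text \<open>For fixed \<open>n\<close>, the value \<open>based_shift b g n\<close> is a polynomial
  sequence in the shift \<open>b\<close>. A nonzero shift fixing \<open>g\<close> is a period of it,
  so it does not depend on \<open>b\<close>; thus all based shifts fix \<open>g\<close>, which is
  additivity.\<close>

lemma based_shift_fixed_additive:
  assumes "poly_seq s g" "g 0 = 0" "based_shift a g = g" "a \<noteq> 0"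
  shows "additive_seq g"
proof -
  have *: "additive_seq g" if a: "based_shift (int m) g = g" "m > 0" for m
    unfolding additive_seq_def
  proof (intro allI)
    fix b n
    define u where "u = - g + shift n g - (\<lambda>_. g n)"
    have u: "u b = based_shift b g n - g n" for b
      by (simp add: u_def based_shift_def shift_def add.commute)
    have "poly_seq s u"
      unfolding u_def using assms(1) poly_seq_shift poly_seq_const_value
      by (intro poly_seq_diff add uminus) auto
    moreover have "u (b + int m) = u b" for b
      unfolding u using based_shift_based_shift[of b "int m" g] a by simp
    ultimately have "u b = u 0" using periodic_poly_seq_const that(2) by blast
    then have "based_shift b g n = g n" unfolding u using assms(2) by (simp add: based_shift_zero)
    then show "g (b + n) = g b + g n"
      unfolding based_shift_def by (metis add.commute add_minus_cancel)
  qed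
  show ?thesis
  proof (cases "a > 0")
    case True
    then show ?thesis using *[of "nat a"] assms by auto
  next
    case False
    have "based_shift (- a) g = g"
      using based_shift_based_shift[of "- a" a g] assms by (simp add: based_shift_zero)
    then show ?thesis using *[of "nat (- a)"] assms False by auto
  qed
qed

end

section \<open>PET induction\<close>

definition lex_less :: "nat \<Rightarrow> ((nat \<Rightarrow> nat) \<times> (nat \<Rightarrow> nat)) set" where
  "lex_less N = {(u, v). \<exists>j<N. u j < v j \<and> (\<forall>i<j. u i \<le> v i)}"

text \<open>Before position \<open>j\<close> only \<open>\<le>\<close> is demanded, but at the first
  position where the two weights differ the left one is still smaller. So the relation embeds into
  the lexicographic order on lists of length \<open>N\<close>.\<close>

lemma wf_lex_less: "wf (lex_less N)"
proof -
  have "(map u [0..<N], map v [0..<N]) \<in> lexn less_than N" if uv: "(u, v) \<in> lex_less N" for u v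
  proof -
    obtain j where j: "j < N" "u j < v j" "\<forall>i<j. u i \<le> v i" using uv by (auto simp: lex_less_def)
    define i where "i = (LEAST i. u i \<noteq> v i)"
    have ne: "u i \<noteq> v i" and le: "i \<le> j"
      unfolding i_def using j LeastI[of "\<lambda>i. u i \<noteq> v i" j] Least_le[of "\<lambda>i. u i \<noteq> v i" j] by auto
    have lt: "u i < v i" using ne le j by (metis le_neq_implies_less)
    have eq: "u l = v l" if "l < i" for l using that not_less_Least[of l] unfolding i_def by blast
    have split: "map w [0..<N] = map w [0..<i] @ w i # map w [Suc i..<N]" for w :: "nat \<Rightarrow> nat"
      using le j(1) upt_add_eq_append[of 0 i "N - i"] upt_conv_Cons[of i N] by simp
    have "map u [0..<N] = map v [0..<i] @ u i # map u [Suc i..<N]"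
      using split[of u] eq by simp
    moreover have "map v [0..<N] = map v [0..<i] @ v i # map v [Suc i..<N]" by (rule split)
    ultimately have "\<exists>xys x y xs' ys'. map u [0..<N] = xys @ x # xs' \<and> map v [0..<N] = xys @ y # ys'
        \<and> (x, y) \<in> less_than"
      using lt by (metis less_than_iff)
    then show ?thesis unfolding lexn_conv by simp
  qed
  then have "lex_less N \<subseteq> inv_image (lexn less_than N) (\<lambda>u. map u [0..<N])"
    by (auto simp: in_inv_image)
  then show ?thesis using wf_subset wf_inv_image wf_lexn wf_less_than by metis
qed

section \<open>Cosets modulo the next level, and the decrease of the weight\<close>

context group_filtration
begin

definition coset_at :: "nat \<Rightarrow> (int \<Rightarrow> 'a) \<Rightarrow> (int \<Rightarrow> 'a) set" where
  "coset_at i g = {x. poly_seq (Suc i) (- g + x)}"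

lemma coset_at_eq_iff: "coset_at i g = coset_at i g' \<longleftrightarrow> poly_seq (Suc i) (- g + g')"
proof
  assume "coset_at i g = coset_at i g'"
  moreover have "g' \<in> coset_at i g'" using poly_seq_zero by (simp add: coset_at_def)
  ultimately show "poly_seq (Suc i) (- g + g')" by (auto simp: coset_at_def)
next
  assume a: "poly_seq (Suc i) (- g + g')"
  have "poly_seq (Suc i) (- g + x) \<longleftrightarrow> poly_seq (Suc i) (- g' + x)" for x
  proof
    assume "poly_seq (Suc i) (- g + x)"
    from add[OF uminus[OF a] this] show "poly_seq (Suc i) (- g' + x)" by (simp add: minus_add add.assoc)
  next
    assume "poly_seq (Suc i) (- g' + x)"
    from add[OF a this] show "poly_seq (Suc i) (- g + x)" by (simp add: add.assoc)
  qed
  then show "coset_at i g = coset_at i g'" by (auto simp: coset_at_def)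
qed

text \<open>By normality of the levels, the coset of \<open>g - f\<close> depends only on the coset
  of \<open>g\<close>. Thus subtracting \<open>f\<close> does not increase the number of
  cosets.\<close>

lemma coset_at_diff:
  assumes "poly_seq m f"
  shows "coset_at i (g - f) = {x. x + f \<in> coset_at i g}"
proof -
  have "poly_seq (Suc i) (- (g - f) + x) \<longleftrightarrow> poly_seq (Suc i) (- g + (x + f))" for x
  proof
    assume "poly_seq (Suc i) (- (g - f) + x)"
    from poly_seq_conj[OF uminus[OF assms] this] show "poly_seq (Suc i) (- g + (x + f))"
      by (simp add: group_word del: add_uminus_conv_diff)
  next
    assume "poly_seq (Suc i) (- g + (x + f))"
    from poly_seq_conj[OF assms this] show "poly_seq (Suc i) (- (g - f) + x)"
      by (simp add: group_word del: add_uminus_conv_diff)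
  qed
  then show ?thesis by (simp add: coset_at_def)
qed

text \<open>
  The weight of the PET induction: the level of a sequence is the largest \<open>i\<close> with
  \<open>poly_seq i g\<close>, so a larger level means a simpler sequence, and two sequences of level \<open>i\<close>
  are equivalent if they agree modulo the next level.
\<close>

definition weight :: "(int \<Rightarrow> 'a) set \<Rightarrow> nat \<Rightarrow> nat" where
  "weight A i = card (coset_at i ` {g \<in> A. poly_seq i g \<and> \<not> poly_seq (Suc i) g})"

lemma poly_seq_based_shift_iff:
  assumes "g 0 = 0"
  shows "poly_seq i (based_shift k g) \<longleftrightarrow> poly_seq i g"
proof
  assume "poly_seq i (based_shift k g)"
  then have "poly_seq i (based_shift (- k) (based_shift k g))" by (rule poly_seq_based_shift)
  then show "poly_seq i g" using assms by (simp add: based_shift_based_shift based_shift_zero)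
qed (rule poly_seq_based_shift)

lemma poly_seq_diff_iff:
  assumes "poly_seq i f"
  shows "poly_seq i (g - f) \<longleftrightarrow> poly_seq i g"
  using poly_seq_diff[OF _ assms, of g] add[OF _ assms, of "g - f"] by auto

lemma coset_at_based_shift:
  assumes "poly_seq i g" "g 0 = 0"
  shows "coset_at i (based_shift k g) = coset_at i g"
proof -
  have "poly_seq (Suc i) (- g + (based_shift k g - g) - (- g))"
    using assms by (intro poly_seq_conj[OF uminus poly_seq_based_shift_diff])
  then have "poly_seq (Suc i) (- g + based_shift k g)"
    by (simp add: group_word del: add_uminus_conv_diff)
  then show ?thesis using coset_at_eq_iff by blast
qed

lemma coset_at_diff_higher:
  assumes "poly_seq (Suc i) f"
  shows "coset_at i (g - f) = coset_at i g"
proof -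
  have "poly_seq (Suc i) (- (g - f) + g)"
    using poly_seq_conj[OF assms, of "Suc i" 0] assms by (simp add: group_word poly_seq_zero del: add_uminus_conv_diff)
  then show ?thesis using coset_at_eq_iff by blast
qed

text \<open>Here \<open>f\<close> has the highest level \<open>j\<close> occurring in
  \<open>A\<close>. Below \<open>j\<close>, neither shifting nor subtracting \<open>f\<close>
  changes the level or the coset of a sequence. At \<open>j\<close>, sequences in the coset of
  \<open>f\<close> move to a higher level, so one coset disappears and the others are at most
  translated. Entries beyond \<open>j\<close> may grow, but they count less in the lexicographic
  order.\<close>

lemma weight_decreases:
  assumes A: "finite A" "\<And>g. g \<in> A \<Longrightarrow> g 0 = 0"
    and f: "f \<in> A" "poly_seq j f" and max: "\<And>g. g \<in> A \<Longrightarrow> \<not> poly_seq (Suc j) g"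
    and A': "\<And>u. u \<in> A' \<Longrightarrow> \<exists>k. \<exists>g\<in>A. u = based_shift k g - f"
  shows "(weight A', weight A) \<in> lex_less N"
proof -
  let ?S = "\<lambda>A i. {g \<in> A. poly_seq i g \<and> \<not> poly_seq (Suc i) g}"
  have "j < N" using max[OF f(1)] f(2) poly_seq_trivial[of j f] poly_seq_zero
    by (metis not_le)
  moreover have "weight A' i \<le> weight A i" if "i < j" for i
  proof -
    have fi: "poly_seq (Suc i) f" using f(2) that poly_seq_antimono by (metis Suc_leI)
    have "coset_at i u \<in> coset_at i ` ?S A i" if u: "u \<in> ?S A' i" for u
    proof -
      obtain k g where g: "g \<in> A" "u = based_shift k g - f" using A' u by blast
      have "g \<in> ?S A i"
        using u g A(2) fi mono[OF fi] by (simp add: poly_seq_diff_iff poly_seq_based_shift_iff)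
      moreover from this have "coset_at i u = coset_at i g" unfolding g(2)
        using A(2)[OF g(1)] fi by (simp add: coset_at_diff_higher coset_at_based_shift)
      ultimately show ?thesis by blast
    qed
    then show ?thesis unfolding weight_def using A(1) by (intro card_mono) auto
  qed
  moreover have "weight A' j < weight A j"
  proof -
    let ?T = "coset_at j ` ?S A j"
    let ?\<Phi> = "\<lambda>c. {x. x + f \<in> c}"
    have "coset_at j u \<in> ?\<Phi> ` (?T - {coset_at j f})" if u: "u \<in> ?S A' j" for u
    proof -
      obtain k g where g: "g \<in> A" "u = based_shift k g - f" using A' u by blast
      have gS: "g \<in> ?S A j"
        using u g A(2) f(2) max by (simp add: poly_seq_diff_iff poly_seq_based_shift_iff)
      then have eq: "coset_at j (based_shift k g) = coset_at j g"
        using A(2) g(1) coset_at_based_shift by auto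
      have "coset_at j g \<noteq> coset_at j f"
      proof
        assume "coset_at j g = coset_at j f"
        then have "poly_seq (Suc j) (- f + based_shift k g)" using eq coset_at_eq_iff by metis
        from poly_seq_conj[OF f(2) this] have "poly_seq (Suc j) u"
          unfolding g(2) by (simp add: group_word del: add_uminus_conv_diff)
        then show False using u by simp
      qed
      moreover have "coset_at j u = ?\<Phi> (coset_at j g)"
        unfolding g(2) coset_at_diff[OF f(2)] eq ..
      ultimately show ?thesis using gS by blast
    qed
    then have "coset_at j ` ?S A' j \<subseteq> ?\<Phi> ` (?T - {coset_at j f})" by blast
    then have "weight A' j \<le> card (?\<Phi> ` (?T - {coset_at j f}))"
      unfolding weight_def using A(1) by (intro card_mono) auto
    also have "\<dots> \<le> card (?T - {coset_at j f})"
      using A(1) by (intro card_image_le) auto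
    also have "\<dots> < card ?T"
      using A(1) f max by (intro card_Diff1_less) auto
    finally show ?thesis unfolding weight_def .
  qed
  ultimately show ?thesis by (auto simp: lex_less_def)
qed

end

text \<open>The two dynamical inputs of the induction: \<open>central_cover\<close> comes from
  minimality of a central element and \<open>additive_mixing\<close> from weak mixing. The finite
  set \<open>F\<close> in the latter leaves room to avoid unwanted shifts.\<close>

locale filtered_action = torsion_free_filtration L E N for L :: "nat \<Rightarrow> 'a::group_add set" and E N +
  fixes X :: "'x topology" and act :: "'a \<Rightarrow> 'x \<Rightarrow> 'x"
  assumes act_add: "a \<in> L 0 \<Longrightarrow> b \<in> L 0 \<Longrightarrow> x \<in> topspace X \<Longrightarrow> act (a + b) x = act a (act b x)"
    and act_zero: "x \<in> topspace X \<Longrightarrow> act 0 x = x"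
    and act_continuous: "a \<in> L 0 \<Longrightarrow> continuous_map X X (act a)"
    and central_cover: "openin X U \<Longrightarrow> U \<noteq> {} \<Longrightarrow>
      \<exists>C. finite C \<and> C \<subseteq> L 0 \<and> (\<forall>c\<in>C. \<forall>a\<in>L 0. c + a = a + c) \<and> topspace X \<subseteq> (\<Union>c\<in>C. act c ` U)"
    and additive_mixing: "finite A \<Longrightarrow> finite F \<Longrightarrow>
      (\<And>g. g \<in> A \<Longrightarrow> additive_seq g \<and> g \<noteq> 0 \<and> range g \<subseteq> L 0) \<Longrightarrow>
      (\<And>g. g \<in> A \<Longrightarrow> openin X (W g) \<and> W g \<noteq> {} \<and> openin X (V g) \<and> V g \<noteq> {}) \<Longrightarrow>
      \<exists>k. k \<notin> F \<and> (\<forall>g\<in>A. \<exists>x\<in>W g. act (g k) x \<in> V g)"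
begin

definition preimage :: "'a \<Rightarrow> 'x set \<Rightarrow> 'x set" where
  "preimage a V = {x \<in> topspace X. act a x \<in> V}"

lemma act_closed: "a \<in> L 0 \<Longrightarrow> x \<in> topspace X \<Longrightarrow> act a x \<in> topspace X"
  using act_continuous continuous_map_image_subset_topspace by fastforce

lemma preimage_open: "a \<in> L 0 \<Longrightarrow> openin X V \<Longrightarrow> openin X (preimage a V)"
  unfolding preimage_def by (rule openin_continuous_map_preimage[OF act_continuous])

lemma preimage_nonempty:
  assumes "a \<in> L 0" "openin X V" "V \<noteq> {}"
  shows "preimage a V \<noteq> {}"
proof -
  obtain v where v: "v \<in> V" "v \<in> topspace X" using assms openin_subset by blast
  have "act a (act (- a) v) = v"
    using act_add[OF assms(1) uminus_L[OF assms(1)] v(2)] act_zero v(2) by simp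
  then show ?thesis using v act_closed[OF uminus_L[OF assms(1)] v(2)] by (auto simp: preimage_def)
qed

text \<open>The shifts are chosen one element of \<open>C\<close> at a time, and each
  \<open>W g\<close> shrinks so that it serves all elements treated so far. A common
  \<open>W g\<close> is needed because a homomorphism \<open>g\<close> equals all its based shifts
  and hence can be given only one target.\<close>

lemma return_times_additive:
  assumes A: "finite A" "\<And>g. g \<in> A \<Longrightarrow> additive_seq g \<and> g \<noteq> 0 \<and> range g \<subseteq> L 0"
    and V: "\<And>g. g \<in> A \<Longrightarrow> openin X (V g) \<and> V g \<noteq> {}"
    and "finite F" "finite C" "C \<subseteq> L 0"
  shows "\<exists>\<kappa> W. (\<forall>g\<in>A. openin X (W g) \<and> W g \<noteq> {} \<and>
      (\<forall>c\<in>C. \<forall>x\<in>W g. act (g (\<kappa> c) - c) x \<in> V g)) \<and>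
      (\<forall>c\<in>C. \<forall>c'\<in>C. c \<noteq> c' \<longrightarrow> \<kappa> c - \<kappa> c' \<notin> F)"
  using assms(5,6)
proof (induction C)
  case empty
  then show ?case using V by auto
next
  case (insert c C)
  have "C \<subseteq> L 0" using insert.prems by simp
  from insert.IH[OF this] obtain \<kappa> W where
    KW: "\<forall>g\<in>A. openin X (W g) \<and> W g \<noteq> {} \<and> (\<forall>c\<in>C. \<forall>x\<in>W g. act (g (\<kappa> c) - c) x \<in> V g)"
    and K: "\<forall>c\<in>C. \<forall>c'\<in>C. c \<noteq> c' \<longrightarrow> \<kappa> c - \<kappa> c' \<notin> F"
    by (elim exE conjE)
  have IH: "\<And>g. g \<in> A \<Longrightarrow> openin X (W g) \<and> W g \<noteq> {}"
      "\<And>g b x. g \<in> A \<Longrightarrow> b \<in> C \<Longrightarrow> x \<in> W g \<Longrightarrow> act (g (\<kappa> b) - b) x \<in> V g"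
      "\<And>b b'. b \<in> C \<Longrightarrow> b' \<in> C \<Longrightarrow> b \<noteq> b' \<Longrightarrow> \<kappa> b - \<kappa> b' \<notin> F"
    using KW K by blast+
  have c: "c \<in> L 0" using insert.prems by simp
  \<comment> \<open>Avoiding \<open>F'\<close> means that the differences between the new shift and
    the old ones, in either order, avoid \<open>F\<close>.\<close>
  define F' where "F' = (\<lambda>(a, b). a + \<kappa> b) ` (F \<times> C) \<union> (\<lambda>(a, b). \<kappa> b - a) ` (F \<times> C)"
  have "finite F'" unfolding F'_def using insert.hyps(1) assms(4) by simp
  have "\<exists>k. k \<notin> F' \<and> (\<forall>g\<in>A. \<exists>x\<in>preimage c (W g). act (g k) x \<in> V g)"
    using V IH(1) preimage_open[OF c] preimage_nonempty[OF c]
    by (intro additive_mixing[OF A(1) \<open>finite F'\<close> A(2)]) simp_all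
  then obtain k where k: "k \<notin> F'" "\<And>g. g \<in> A \<Longrightarrow> \<exists>x\<in>preimage c (W g). act (g k) x \<in> V g"
    by blast
  define W' where "W' g = W g \<inter> preimage (g k - c) (V g)" for g
  have L: "g k \<in> L 0" "g k - c \<in> L 0" if "g \<in> A" for g
    using A(2)[OF that] add_L[OF _ uminus_L[OF c], of "g k"] by auto
  have "openin X (W' g)" if "g \<in> A" for g
    unfolding W'_def using that IH(1) V L preimage_open by (intro openin_Int) auto
  moreover have "W' g \<noteq> {}" if g: "g \<in> A" for g
  proof -
    obtain w where w: "w \<in> topspace X" "act c w \<in> W g" "act (g k) w \<in> V g"
      using k(2)[OF g] by (auto simp: preimage_def)
    have "act (g k - c) (act c w) = act (g k) w"
      using act_add[OF L(2)[OF g] c w(1)] by simp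
    then show ?thesis unfolding W'_def preimage_def using w act_closed[OF c] by auto
  qed
  moreover have "act (g ((\<kappa>(c := k)) b) - b) x \<in> V g" if "g \<in> A" "b \<in> insert c C" "x \<in> W' g" for g b x
    using that IH(2) by (auto simp: W'_def preimage_def)
  moreover have "(\<kappa>(c := k)) b - (\<kappa>(c := k)) b' \<notin> F" if "b \<in> insert c C" "b' \<in> insert c C" "b \<noteq> b'" for b b'
  proof -
    have "k - \<kappa> b \<notin> F" "\<kappa> b - k \<notin> F" if "b \<in> C" for b
      using k(1) that unfolding F'_def by (force simp: image_iff)+
    then show ?thesis using that IH(3) by auto
  qed
  ultimately show ?case by (intro exI[of _ "\<kappa>(c := k)"] exI[of _ W']) blast
qed

text \<open>Each pair \<open>g\<close>, \<open>g'\<close> contributes at most one shift: two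
  different shifts taking \<open>g\<close> to \<open>g'\<close> yield a nonzero shift fixing
  \<open>g\<close>, so \<open>g\<close> is additive, and then \<open>g' = g\<close>.\<close>

lemma finite_coincidences:
  assumes "finite A" "\<And>g. g \<in> A \<Longrightarrow> poly_seq 1 g \<and> g 0 = 0"
  shows "finite {a. \<exists>g\<in>A. \<exists>g'\<in>A. based_shift a g = g' \<and> \<not> (g = g' \<and> additive_seq g)}"
proof -
  have "finite {a. based_shift a g = g' \<and> \<not> (g = g' \<and> additive_seq g)}" if "g \<in> A" for g g'
  proof -
    have "a = b" if ab: "based_shift a g = g'" "based_shift b g = g'" "\<not> (g = g' \<and> additive_seq g)" for a b
    proof (rule ccontr)
      assume "a \<noteq> b"
      have "based_shift (a - b) g = based_shift (- b) (based_shift a g)"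
        by (simp add: based_shift_based_shift)
      also have "\<dots> = g"
        unfolding ab(1) ab(2)[symmetric] using assms(2)[OF \<open>g \<in> A\<close>]
        by (simp add: based_shift_based_shift based_shift_zero)
      finally have "additive_seq g"
        using based_shift_fixed_additive[of 1 g "a - b"] assms(2)[OF \<open>g \<in> A\<close>] \<open>a \<noteq> b\<close> by simp
      then show False using ab additive_seq_based_shift by metis
    qed
    then have "{a. based_shift a g = g' \<and> \<not> (g = g' \<and> additive_seq g)} \<subseteq>
        {THE a. based_shift a g = g' \<and> \<not> (g = g' \<and> additive_seq g)}"
      by (auto intro!: the_equality[symmetric])
    then show ?thesis by (rule finite_subset) simp
  qed
  then have "finite (\<Union>g\<in>A. \<Union>g'\<in>A. {a. based_shift a g = g' \<and> \<not> (g = g' \<and> additive_seq g)})"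
    using assms(1) by (intro finite_UN_I) simp_all
  then show ?thesis by (rule rev_finite_subset) auto
qed

theorem poly_seq_recurrence:
  assumes "finite A" "\<And>g. g \<in> A \<Longrightarrow> poly_seq 1 g \<and> g 0 = 0 \<and> g \<noteq> 0"
    and "openin X U" "U \<noteq> {}" "\<And>g. g \<in> A \<Longrightarrow> openin X (V g) \<and> V g \<noteq> {}"
  shows "\<exists>n. \<exists>z\<in>U. \<forall>g\<in>A. act (g n) z \<in> V g"
  using assms
proof (induction A arbitrary: U V rule: wf_induct_rule[OF wf_inv_image[OF wf_lex_less[of N], of weight]])
  case (1 A U V)
  note A = "1.prems"(1,2) and U = "1.prems"(3,4) and V = "1.prems"(5)
  show ?case
  proof (cases "A = {}")
    case True
    then show ?thesis using U by auto
  next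
    case False
    \<comment> \<open>The highest level attained in \<open>A\<close>; the sequence \<open>f\<close>
      found below at this level is a simplest one.\<close>
    define j where "j = (LEAST j. \<forall>g\<in>A. \<not> poly_seq (Suc j) g)"
    have "\<forall>g\<in>A. \<not> poly_seq (Suc N) g" using A(2) poly_seq_trivial by (meson le_SucI order_refl)
    then have max: "\<And>g. g \<in> A \<Longrightarrow> \<not> poly_seq (Suc j) g"
      unfolding j_def using LeastI[of "\<lambda>j. \<forall>g\<in>A. \<not> poly_seq (Suc j) g" N] by blast
    obtain f where f: "f \<in> A" "poly_seq j f"
    proof (cases j)
      case 0
      then show ?thesis using that False A(2) mono by (metis One_nat_def ex_in_conv)
    next
      case (Suc i)
      then have "\<not> (\<forall>g\<in>A. \<not> poly_seq (Suc i) g)"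
        using not_less_Least[of i "\<lambda>j. \<forall>g\<in>A. \<not> poly_seq (Suc j) g"] unfolding j_def by simp
      then show ?thesis using that Suc by blast
    qed
    have range0: "g n \<in> L 0" if "poly_seq 1 g" for g n
      using poly_seq_range[OF poly_seq_antimono[OF that, of 0]] by auto
    have neg0: "a - c \<in> L 0" if "a \<in> L 0" "c \<in> L 0" for a c
      using add_L[OF that(1) uminus_L[OF that(2)]] by simp
    obtain C where C: "finite C" "C \<subseteq> L 0" "\<And>c a. c \<in> C \<Longrightarrow> a \<in> L 0 \<Longrightarrow> c + a = a + c"
      "topspace X \<subseteq> (\<Union>c\<in>C. act c ` U)"
      using central_cover[OF U] by blast
    define F where "F = {a. \<exists>g\<in>A. \<exists>g'\<in>A. based_shift a g = g' \<and> \<not> (g = g' \<and> additive_seq g)}"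
    have "finite F" unfolding F_def using A by (intro finite_coincidences) auto
    let ?A = "{g \<in> A. additive_seq g}"
    have "\<exists>\<kappa> W. (\<forall>g\<in>?A. openin X (W g) \<and> W g \<noteq> {} \<and>
        (\<forall>c\<in>C. \<forall>x\<in>W g. act (g (\<kappa> c) - c) x \<in> V g)) \<and>
        (\<forall>c\<in>C. \<forall>c'\<in>C. c \<noteq> c' \<longrightarrow> \<kappa> c - \<kappa> c' \<notin> F)"
    proof (rule return_times_additive[OF _ _ _ \<open>finite F\<close> C(1,2)])
      show "finite ?A" using A(1) by simp
      show "additive_seq g \<and> g \<noteq> 0 \<and> range g \<subseteq> L 0" if "g \<in> ?A" for g
        using that A(2) range0 by blast
      show "openin X (V g) \<and> V g \<noteq> {}" if "g \<in> ?A" for g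
        using that V by blast
    qed
    then obtain \<kappa> W where KW: "\<forall>g\<in>?A. openin X (W g) \<and> W g \<noteq> {} \<and>
        (\<forall>c\<in>C. \<forall>x\<in>W g. act (g (\<kappa> c) - c) x \<in> V g)"
      and \<kappa>: "\<forall>c\<in>C. \<forall>c'\<in>C. c \<noteq> c' \<longrightarrow> \<kappa> c - \<kappa> c' \<notin> F"
      by (elim exE conjE)
    have W: "openin X (W g)" "W g \<noteq> {}"
      "\<And>c x. c \<in> C \<Longrightarrow> x \<in> W g \<Longrightarrow> act (g (\<kappa> c) - c) x \<in> V g"
      if "g \<in> A" "additive_seq g" for g
      using KW that by blast+
    \<comment> \<open>As the shifts avoid \<open>F\<close>, shifted sequences coincide only for the same \<open>g\<close>, and for different
      \<open>c\<close> only if \<open>g\<close> is additive; so the target depends only on the shifted sequence.\<close>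
    define tgt where "tgt = (\<lambda>(g, c). if additive_seq g then W g else preimage (g (\<kappa> c) - c) (V g))"
    have tgt_open: "openin X (tgt (g, c)) \<and> tgt (g, c) \<noteq> {}" if "g \<in> A" "c \<in> C" for g c
    proof (cases "additive_seq g")
      case True
      then show ?thesis using W that by (simp add: tgt_def)
    next
      case False
      have "g (\<kappa> c) - c \<in> L 0" using that A(2) C(2) range0 neg0 by blast
      then show ?thesis using False V[OF that(1)] preimage_open preimage_nonempty
        by (simp add: tgt_def)
    qed
    have tgt_act: "act (g (\<kappa> c) - c) x \<in> V g" if "g \<in> A" "c \<in> C" "x \<in> tgt (g, c)" for g c x
      using that W(3) by (simp add: tgt_def preimage_def split: if_splits)
    define sh :: "(int \<Rightarrow> 'a) \<times> 'a \<Rightarrow> int \<Rightarrow> 'a"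
      where "sh = (\<lambda>(g, c). based_shift (\<kappa> c) g)"
    have tgt_eq: "tgt (g, c) = tgt (g', c')"
      if "g \<in> A" "c \<in> C" "g' \<in> A" "c' \<in> C" "sh (g, c) = sh (g', c')" for g c g' c'
    proof (cases "c = c'")
      case True
      have "g = g'"
        using A(2)[OF that(1)] A(2)[OF that(3)] that(5) True
        by (intro based_shift_inj[of g g' "\<kappa> c"]) (simp_all add: sh_def)
      then show ?thesis using True by simp
    next
      case False
      have "based_shift (\<kappa> c - \<kappa> c') g = based_shift (- \<kappa> c') (based_shift (\<kappa> c) g)"
        by (simp add: based_shift_based_shift)
      also have "\<dots> = based_shift (- \<kappa> c') (based_shift (\<kappa> c') g')" using that by (simp add: sh_def)
      also have "\<dots> = g'" using A(2)[OF that(3)] by (simp add: based_shift_based_shift based_shift_zero)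
      finally have eq: "based_shift (\<kappa> c - \<kappa> c') g = g'" .
      have "\<kappa> c - \<kappa> c' \<notin> F" using \<kappa> that(2,4) False by blast
      then have "g = g' \<and> additive_seq g" using eq that(1,3) unfolding F_def by blast
      then show ?thesis by (auto simp: tgt_def)
    qed
    define B where "B = sh ` (A \<times> C)"
    \<comment> \<open>Several pairs can produce the same shifted sequence; by \<open>tgt_eq\<close>
      the target does not depend on the pair picked by \<open>inv_into\<close>.\<close>
    define Y where "Y h = tgt (inv_into (A \<times> C) sh h)" for h
    have Y: "Y (based_shift (\<kappa> c) g) = tgt (g, c)" if "g \<in> A" "c \<in> C" for g c
    proof -
      have h: "sh (g, c) \<in> sh ` (A \<times> C)" using that by blast
      obtain g' c' where eq: "inv_into (A \<times> C) sh (sh (g, c)) = (g', c')" by fastforce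
      then have "g' \<in> A" "c' \<in> C" "sh (g', c') = sh (g, c)"
        using inv_into_into[OF h] f_inv_into_f[OF h] by auto
      from tgt_eq[OF this(1,2) that this(3)] show ?thesis using eq by (simp add: Y_def sh_def)
    qed
    have Y_open: "openin X (Y h) \<and> Y h \<noteq> {}" if hB: "h \<in> B" for h
    proof -
      obtain g c where "g \<in> A" "c \<in> C" "h = based_shift (\<kappa> c) g"
        using hB unfolding B_def sh_def by force
      then show ?thesis using Y tgt_open by simp
    qed
    \<comment> \<open>If \<open>f\<close> itself is among the shifted sequences, its difference 0 is
      dropped, and the target of \<open>f\<close> is imposed on the starting point through
      \<open>U'\<close>.\<close>
    define A' where "A' = (\<lambda>h. h - f) ` B - {0}"
    have A': "\<exists>k. \<exists>g\<in>A. u = based_shift k g - f" if "u \<in> A'" for u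
      using that unfolding A'_def B_def sh_def by force
    have "finite A'" using A(1) C(1) by (simp add: A'_def B_def)
    have A'_poly: "poly_seq 1 u \<and> u 0 = 0 \<and> u \<noteq> 0" if u: "u \<in> A'" for u
    proof -
      obtain k g where g: "g \<in> A" "u = based_shift k g - f" using A'[OF u] by blast
      then have "poly_seq 1 u" using A(2) f(1) by (metis poly_seq_diff poly_seq_based_shift)
      moreover have "u 0 = 0" using A(2)[OF f(1)] g(2) by (simp add: based_shift_at_zero)
      moreover have "u \<noteq> 0" using u unfolding A'_def by blast
      ultimately show ?thesis by blast
    qed
    have less: "(A', A) \<in> inv_image (lex_less N) weight"
      unfolding in_inv_image using A(2) by (intro weight_decreases[OF A(1) _ f max A']) auto
    define U' where "U' = (if f \<in> B then Y f else topspace X)"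
    have "topspace X \<noteq> {}" using U openin_subset by fastforce
    then have U': "openin X U'" "U' \<noteq> {}" using Y_open by (auto simp: U'_def)
    have "openin X (Y (u + f)) \<and> Y (u + f) \<noteq> {}" if "u \<in> A'" for u
      using that Y_open by (auto simp: A'_def)
    then obtain n x where x: "x \<in> U'" "\<And>u. u \<in> A' \<Longrightarrow> act (u n) x \<in> Y (u + f)"
      using "1.IH"[OF less \<open>finite A'\<close> A'_poly U', of "\<lambda>u. Y (u + f)"] by blast
    have xX: "x \<in> topspace X" using x(1) U'(1) openin_subset by blast
    have fn: "f n \<in> L 0" "- f n \<in> L 0" using f A(2) range0 uminus_L by blast+
    \<comment> \<open>With this choice \<open>h n\<close> acts on \<open>y\<close> as
      \<open>(h - f) n\<close> acts on \<open>x\<close>, so the conditions on \<open>x\<close>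
      become conditions on \<open>y\<close> for all \<open>h\<close> in \<open>B\<close>, including
      \<open>f\<close>.\<close>
    define y where "y = act (- f n) x"
    have yX: "y \<in> topspace X" using act_closed[OF fn(2) xX] by (simp add: y_def)
    then obtain c z where c: "c \<in> C" and z: "z \<in> U" "y = act c z" using C(4) by blast
    have zX: "z \<in> topspace X" using z(1) U(1) openin_subset by blast
    have "act (g (n + \<kappa> c)) z \<in> V g" if g: "g \<in> A" for g
    proof -
      define h where "h = based_shift (\<kappa> c) g"
      have hB: "h \<in> B" using g c unfolding B_def h_def sh_def by force
      have hL: "h n \<in> L 0" unfolding h_def using A(2) g poly_seq_based_shift range0 by blast
      have hy: "act (h n) y = act (h n - f n) x"
        unfolding y_def using act_add[OF hL fn(2) xX] by simp
      have "act (h n) y \<in> Y h"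
      proof (cases "h = f")
        case True
        then show ?thesis using hB x(1) act_zero[OF xX] unfolding hy by (simp add: U'_def)
      next
        case False
        then have "h - f \<in> A'" using hB by (auto simp: A'_def)
        from x(2)[OF this] show ?thesis unfolding hy by simp
      qed
      then have "act (g (\<kappa> c) - c) (act (h n) y) \<in> V g"
        using tgt_act[OF g c] Y[OF g c] by (simp add: h_def)
      moreover have cL: "c \<in> L 0" "g (\<kappa> c) - c \<in> L 0"
        using c C(2) A(2) g range0 neg0 by blast+
      then have "act (g (\<kappa> c) - c) (act (h n) y) = act ((g (\<kappa> c) - c) + (h n + c)) z"
        using act_add[OF cL(2) _ zX, of "h n + c"] act_add[OF hL cL(1) zX] add_L[OF hL cL(1)] z(2) by simp
      \<comment> \<open>Since \<open>c\<close> commutes with \<open>h n\<close>, it cancels; then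
        \<open>g (\<kappa> c)\<close> cancels the base factor of the based shift.\<close>
      moreover have "(g (\<kappa> c) - c) + (h n + c) = g (n + \<kappa> c)"
        using C(3)[OF c hL, symmetric]
        by (simp add: h_def based_shift_def group_word del: add_uminus_conv_diff)
      ultimately show ?thesis by simp
    qed
    then show ?thesis using z(1) by blast
  qed
qed

end

section \<open>Return times of weakly mixing minimal systems\<close>

text \<open>For each finite window \<open>K\<close>, the positions whose whole window lies in
  \<open>A\<close> form a syndetic set: every translate of the finite set \<open>F\<close> contains
  one.\<close>

definition thickly_syndetic :: "int set \<Rightarrow> bool" where
  "thickly_syndetic A \<longleftrightarrow>
     (\<forall>K. finite K \<longrightarrow> (\<exists>F. finite F \<and> (\<forall>m. \<exists>j\<in>F. \<forall>l\<in>K. m + j + l \<in> A)))"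

text \<open>Once \<open>FB\<close> is known for \<open>B\<close> and \<open>K\<close>, the set
  \<open>A\<close> is asked for the larger window \<open>FB + K\<close>; inside it \<open>B\<close>
  still finds a good position for \<open>K\<close>.\<close>

lemma thickly_syndetic_Int:
  assumes "thickly_syndetic A" "thickly_syndetic B"
  shows "thickly_syndetic (A \<inter> B)"
  unfolding thickly_syndetic_def
proof (intro allI impI)
  fix K :: "int set" assume "finite K"
  then obtain FB where FB: "finite FB" "\<And>m. \<exists>j\<in>FB. \<forall>l\<in>K. m + j + l \<in> B"
    using assms(2) unfolding thickly_syndetic_def by meson
  define KA where "KA = (\<lambda>(j, l). j + l) ` (FB \<times> K)"
  have "finite KA" using FB(1) \<open>finite K\<close> by (simp add: KA_def)
  then obtain FA where FA: "finite FA" "\<And>m. \<exists>j\<in>FA. \<forall>l\<in>KA. m + j + l \<in> A"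
    using assms(1) unfolding thickly_syndetic_def by meson
  let ?F = "(\<lambda>(i, j). i + j) ` (FA \<times> FB)"
  have "\<exists>j\<in>?F. \<forall>l\<in>K. m + j + l \<in> A \<inter> B" for m
  proof -
    obtain i where i: "i \<in> FA" "\<And>l. l \<in> KA \<Longrightarrow> m + i + l \<in> A" using FA(2) by blast
    obtain j where j: "j \<in> FB" "\<And>l. l \<in> K \<Longrightarrow> (m + i) + j + l \<in> B" using FB(2) by blast
    have "m + (i + j) + l \<in> A \<inter> B" if "l \<in> K" for l
    proof -
      have "j + l \<in> KA" using j(1) that by (force simp: KA_def)
      then show ?thesis using i(2) j(2)[OF that] by (force simp: add.assoc)
    qed
    then show ?thesis using i(1) j(1) by force
  qed
  moreover have "finite ?F" using FA(1) FB(1) by simp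
  ultimately show "\<exists>F. finite F \<and> (\<forall>m. \<exists>j\<in>F. \<forall>l\<in>K. m + j + l \<in> A \<inter> B)" by blast
qed

lemma thickly_syndetic_UNIV: "thickly_syndetic UNIV"
  unfolding thickly_syndetic_def by blast

lemma thickly_syndetic_INT:
  assumes "finite I" "\<And>i. i \<in> I \<Longrightarrow> thickly_syndetic (A i)"
  shows "thickly_syndetic (\<Inter>i\<in>I. A i)"
  using assms by (induction I) (auto intro: thickly_syndetic_Int simp: thickly_syndetic_UNIV)

lemma thickly_syndetic_not_subset_finite:
  assumes "thickly_syndetic A" "finite B"
  obtains k where "k \<in> A" "k \<notin> B"
proof -
  obtain F where F: "finite F" "\<And>m. \<exists>j\<in>F. \<forall>l\<in>{0}. m + j + l \<in> A"
    using assms(1) unfolding thickly_syndetic_def by (meson finite.emptyI finite_insert)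
  have "finite ((\<lambda>(b, j). b - j) ` (B \<times> F))" using F(1) assms(2) by simp
  then obtain m :: int where m: "m \<notin> (\<lambda>(b, j). b - j) ` (B \<times> F)"
    using ex_new_if_finite infinite_UNIV_int by blast
  obtain j where "j \<in> F" "m + j \<in> A" using F(2)[of m] by auto
  moreover have "m + j \<notin> B" using m \<open>j \<in> F\<close> by (force simp: image_iff)
  ultimately show ?thesis using that by blast
qed

section \<open>Integer actions: minimality, weak mixing and return times\<close>

locale int_system =
  fixes X :: "'x topology" and \<alpha> :: "int \<Rightarrow> 'x \<Rightarrow> 'x"
  assumes continuous: "continuous_map X X (\<alpha> n)"
    and zero: "x \<in> topspace X \<Longrightarrow> \<alpha> 0 x = x"
    and add: "x \<in> topspace X \<Longrightarrow> \<alpha> (m + n) x = \<alpha> m (\<alpha> n x)"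
begin

definition pre :: "int \<Rightarrow> 'x set \<Rightarrow> 'x set" where
  "pre n V = {x \<in> topspace X. \<alpha> n x \<in> V}"

definition hits :: "'x set \<Rightarrow> 'x set \<Rightarrow> int set" where
  "hits U V = {n. \<exists>x\<in>U. \<alpha> n x \<in> V}"

lemma closed: "x \<in> topspace X \<Longrightarrow> \<alpha> n x \<in> topspace X"
  using continuous continuous_map_image_subset_topspace by fastforce

lemma open_pre: "openin X V \<Longrightarrow> openin X (pre n V)"
  unfolding pre_def by (rule openin_continuous_map_preimage[OF continuous])

lemma cancel: "x \<in> topspace X \<Longrightarrow> \<alpha> n (\<alpha> (- n) x) = x" "x \<in> topspace X \<Longrightarrow> \<alpha> (- n) (\<alpha> n x) = x"
  using add[of x n "- n"] add[of x "- n" n] zero by auto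

lemma pre_nonempty:
  assumes "openin X V" "V \<noteq> {}"
  shows "pre n V \<noteq> {}"
proof -
  obtain v where v: "v \<in> V" "v \<in> topspace X" using assms openin_subset by blast
  then have "\<alpha> (- n) v \<in> pre n V" using cancel(1)[OF v(2), of n] closed by (simp add: pre_def)
  then show ?thesis by blast
qed

text \<open>The points whose orbit misses \<open>U\<close> form a proper closed invariant set, which
  is empty by minimality; compactness then selects finitely many preimages.\<close>

lemma minimal_cover:
  assumes "compact_space X" "minimal_system X integer_group \<alpha>" "openin X U" "U \<noteq> {}"
  shows "\<exists>F. finite F \<and> topspace X \<subseteq> (\<Union>j\<in>F. pre j U)"
proof -
  let ?C = "topspace X - (\<Union>j. pre j U)"
  have "U \<subseteq> pre 0 U" using openin_subset[OF assms(3)] zero by (auto simp: pre_def)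
  then have "?C \<noteq> topspace X" using assms(3,4) openin_subset by blast
  moreover have "closedin X ?C"
    using open_pre[OF assms(3)] by (intro closedin_diff closedin_topspace openin_Union) blast
  moreover have "invariant_set integer_group \<alpha> ?C"
    unfolding invariant_set_def
  proof clarify
    fix n x j assume x: "x \<in> topspace X" "x \<notin> (\<Union>j. pre j U)"
    show "\<alpha> n x \<in> ?C" using x add[OF x(1), of _ n, symmetric] closed[OF x(1), of n]
      by (auto simp: pre_def)
  qed
  ultimately have "topspace X = \<Union> (range (\<lambda>j. pre j U))"
  proof -
    have "?C = {}" using \<open>?C \<noteq> topspace X\<close> \<open>closedin X ?C\<close> \<open>invariant_set integer_group \<alpha> ?C\<close>
      using assms(2) unfolding minimal_system_def by blast
    moreover have "\<Union> (range (\<lambda>j. pre j U)) \<subseteq> topspace X" by (auto simp: pre_def)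
    ultimately show ?thesis by blast
  qed
  moreover have "\<And>V. V \<in> range (\<lambda>j. pre j U) \<Longrightarrow> openin X V" using open_pre assms(3) by auto
  ultimately obtain \<F> where "finite \<F>" "\<F> \<subseteq> range (\<lambda>j. pre j U)" "topspace X \<subseteq> \<Union>\<F>"
    using assms(1) unfolding compact_space_alt by (metis order_refl)
  moreover from this obtain F where "finite F" "\<F> = (\<lambda>j. pre j U) ` F"
    by (meson finite_subset_image)
  ultimately show ?thesis by auto
qed

text \<open>Furstenberg's intersection argument. The saturation of \<open>U1 \<times> V1\<close>
  under the diagonal action is dense, so it meets \<open>U2 \<times> V2\<close> at some time
  \<open>k\<close>. As times commute, \<open>pre k U1 \<inter> U2\<close> and
  \<open>pre k V1 \<inter> V2\<close> have only common return times.\<close>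

lemma weakly_mixing_Int_hits:
  assumes "weakly_mixing_system X integer_group \<alpha>"
    and U: "openin X U1" "U1 \<noteq> {}" "openin X U2" "U2 \<noteq> {}"
    and V: "openin X V1" "V1 \<noteq> {}" "openin X V2" "V2 \<noteq> {}"
  shows "\<exists>U3 V3. openin X U3 \<and> U3 \<noteq> {} \<and> openin X V3 \<and> V3 \<noteq> {} \<and> hits U3 V3 \<subseteq> hits U1 V1 \<inter> hits U2 V2"
proof -
  let ?P = "prod_topology X X"
  let ?W = "\<Union>k. pre k U1 \<times> pre k V1"
  have "openin ?P ?W"
    using open_pre[OF U(1)] open_pre[OF V(1)]
    by (intro openin_Union) (auto simp: openin_prod_Times_iff)
  moreover have "?W \<noteq> {}" using pre_nonempty[OF U(1,2)] pre_nonempty[OF V(1,2)] by auto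
  moreover have "invariant_set integer_group (\<lambda>n (x, y). (\<alpha> n x, \<alpha> n y)) ?W"
    unfolding invariant_set_def
  proof clarify
    fix n k x y assume xy: "x \<in> pre k U1" "y \<in> pre k V1"
    then have "\<alpha> n x \<in> pre (k - n) U1" "\<alpha> n y \<in> pre (k - n) V1"
      using add[of _ "k - n" n] closed by (auto simp: pre_def)
    then show "(\<alpha> n x, \<alpha> n y) \<in> ?W" by blast
  qed
  ultimately have dense: "?P closure_of ?W = topspace ?P"
    using assms(1) unfolding weakly_mixing_system_def transitive_system_def by blast
  have "openin ?P (U2 \<times> V2)" "U2 \<times> V2 \<noteq> {}" using U V by (auto simp: openin_prod_Times_iff)
  then have "?W \<inter> (U2 \<times> V2) \<noteq> {}"
    using dense unfolding dense_intersects_open by blast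
  then obtain q where "q \<in> ?W" "q \<in> U2 \<times> V2" by (meson disjoint_iff)
  then obtain k x y where k: "x \<in> pre k U1" "y \<in> pre k V1" "x \<in> U2" "y \<in> V2"
    by (elim UN_E SigmaE) simp
  have "hits (pre k U1 \<inter> U2) (pre k V1 \<inter> V2) \<subseteq> hits U1 V1 \<inter> hits U2 V2"
  proof
    fix m assume "m \<in> hits (pre k U1 \<inter> U2) (pre k V1 \<inter> V2)"
    then obtain x where x: "x \<in> pre k U1" "x \<in> U2" "\<alpha> m x \<in> pre k V1" "\<alpha> m x \<in> V2"
      by (auto simp: hits_def)
    then have "\<alpha> m (\<alpha> k x) = \<alpha> k (\<alpha> m x)"
      using add[of x m k] add[of x k m] by (simp add: pre_def add.commute)
    then have "\<alpha> k x \<in> U1" "\<alpha> m (\<alpha> k x) \<in> V1" using x by (simp_all add: pre_def)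
    then show "m \<in> hits U1 V1 \<inter> hits U2 V2" using x(2,4) unfolding hits_def by blast
  qed
  moreover have "openin X (pre k U1 \<inter> U2)" "openin X (pre k V1 \<inter> V2)"
    using U V open_pre by auto
  moreover have "pre k U1 \<inter> U2 \<noteq> {}" "pre k V1 \<inter> V2 \<noteq> {}" using k by auto
  ultimately show ?thesis by metis
qed

text \<open>Iterating the intersection lemma over \<open>K\<close> gives \<open>U'\<close> and
  \<open>V'\<close> such that every return time begins a full window of return times from
  \<open>U\<close> to \<open>V\<close>. By minimality the orbit of one point of \<open>U'\<close>
  visits \<open>V'\<close> with bounded gaps.\<close>

lemma thickly_syndetic_hits:
  assumes "compact_space X" "minimal_system X integer_group \<alpha>" "weakly_mixing_system X integer_group \<alpha>"
    and "openin X U" "U \<noteq> {}" "openin X V" "V \<noteq> {}"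
  shows "thickly_syndetic (hits U V)"
  unfolding thickly_syndetic_def
proof (intro allI impI)
  fix K :: "int set" assume "finite K"
  then have "\<exists>U' V'. openin X U' \<and> U' \<noteq> {} \<and> openin X V' \<and> V' \<noteq> {} \<and>
    (\<forall>m\<in>hits U' V'. \<forall>l\<in>K. m + l \<in> hits U V)"
  proof (induction K)
    case empty
    then show ?case using assms(4-7) by auto
  next
    case (insert l K)
    then obtain U1 V1 where 1: "openin X U1" "U1 \<noteq> {}" "openin X V1" "V1 \<noteq> {}"
      "\<forall>m\<in>hits U1 V1. \<forall>l\<in>K. m + l \<in> hits U V" by blast
    obtain U' V' where U': "openin X U'" "U' \<noteq> {}" "openin X V'" "V' \<noteq> {}"
      "hits U' V' \<subseteq> hits U1 V1 \<inter> hits U (pre l V)"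
      using weakly_mixing_Int_hits[OF assms(3) 1(1,2) assms(4,5) 1(3,4) open_pre pre_nonempty] assms(6,7)
      by metis
    have "m + l \<in> hits U V" if "m \<in> hits U (pre l V)" for m
    proof -
      obtain x where x: "x \<in> U" "\<alpha> m x \<in> pre l V" using \<open>m \<in> hits U (pre l V)\<close> by (auto simp: hits_def)
      moreover have "x \<in> topspace X" using x(1) openin_subset[OF assms(4)] by blast
      ultimately have "\<alpha> (m + l) x \<in> V" using add[of x l m] by (simp add: pre_def add.commute)
      then show ?thesis using x(1) by (auto simp: hits_def)
    qed
    then have "\<forall>m\<in>hits U' V'. \<forall>l'\<in>insert l K. m + l' \<in> hits U V" using 1(5) U'(5) by blast
    then show ?case using U' by blast
  qed
  then obtain U' V' where U': "openin X U'" "U' \<noteq> {}" "openin X V'" "V' \<noteq> {}"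
    "\<And>m l. m \<in> hits U' V' \<Longrightarrow> l \<in> K \<Longrightarrow> m + l \<in> hits U V" by blast
  obtain F where F: "finite F" "topspace X \<subseteq> (\<Union>j\<in>F. pre j V')"
    using minimal_cover[OF assms(1,2) U'(3,4)] by blast
  obtain x where x: "x \<in> U'" "x \<in> topspace X" using U'(1,2) openin_subset by fast
  have "\<exists>j\<in>F. \<forall>l\<in>K. m + j + l \<in> hits U V" for m
  proof -
    obtain j where "j \<in> F" "\<alpha> m x \<in> pre j V'" using F(2) closed[OF x(2)] by blast
    moreover from this have "\<alpha> (m + j) x \<in> V'"
      using add[OF x(2), of j m] by (simp add: pre_def add.commute)
    then have "m + j \<in> hits U' V'" using x(1) by (auto simp: hits_def)
    ultimately show ?thesis using U'(5) by blast
  qed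
  then show "\<exists>F. finite F \<and> (\<forall>m. \<exists>j\<in>F. \<forall>l\<in>K. m + j + l \<in> hits U V)" using F(1) by blast
qed

end

section \<open>The acting group as a group of bijections\<close>

text \<open>The PET part works in a type of class \<open>group_add\<close>, whereas the acting group
  lives on a carrier set. It is therefore represented by permutations of the whole type, acting as
  the identity outside \<open>M\<close>.\<close>

typedef 'x bijection = "{f :: 'x \<Rightarrow> 'x. bij f}"
  by (rule exI[of _ id]) simp

setup_lifting type_definition_bijection

instantiation bijection :: (type) group_add
begin

lift_definition zero_bijection :: "'a bijection" is id by simp
lift_definition plus_bijection :: "'a bijection \<Rightarrow> 'a bijection \<Rightarrow> 'a bijection" is "(\<circ>)"
  by (rule bij_comp)
lift_definition uminus_bijection :: "'a bijection \<Rightarrow> 'a bijection" is "inv_into UNIV"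
  by (rule bij_imp_bij_inv)
definition minus_bijection :: "'a bijection \<Rightarrow> 'a bijection \<Rightarrow> 'a bijection" where
  "minus_bijection f g = f + - g"

instance
proof
  fix a b c :: "'a bijection"
  show "a + b + c = a + (b + c)" by transfer (simp add: comp_assoc)
  show "0 + a = a" by transfer simp
  show "a + 0 = a" by transfer simp
  show "- a + a = 0" by transfer (simp add: bij_is_inj)
  show "a + - b = a - b" by (simp add: minus_bijection_def)
qed

end

section \<open>Lower central series and the center of a nilpotent group\<close>

context group
begin

lemma lower_central_series_subset_carrier: "lower_central_series G n \<subseteq> carrier G"
proof (induction n)
  case (Suc n)
  then show ?case unfolding lower_central_series.simps by (intro generate_incl) blast
qed simp

lemma subgroup_lower_central_series: "subgroup (lower_central_series G n) G"
proof (cases n)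
  case 0
  then show ?thesis by (simp add: subgroup_self)
next
  case (Suc n)
  then show ?thesis using lower_central_series_subset_carrier[of n]
    unfolding lower_central_series.simps by (auto intro!: generate_is_subgroup)
qed

lemma lower_central_series_commutator:
  assumes "x \<in> lower_central_series G n" "y \<in> carrier G"
  shows "x \<otimes> y \<otimes> inv x \<otimes> inv y \<in> lower_central_series G (Suc n)"
  unfolding lower_central_series.simps using assms by (intro generate.incl) blast

lemma lower_central_series_Suc_subset: "lower_central_series G (Suc n) \<subseteq> lower_central_series G n"
proof (induction n)
  case 0
  then show ?case using lower_central_series_subset_carrier[of 1] by simp
next
  case (Suc n)
  show ?case unfolding lower_central_series.simps(2)[of _ "Suc n"]
    by (subst lower_central_series.simps(2), rule mono_generate) (use Suc in blast)
qed

lemma lower_central_series_antimono: "i \<le> j \<Longrightarrow> lower_central_series G j \<subseteq> lower_central_series G i"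
  using lift_Suc_antimono_le[of "lower_central_series G"] lower_central_series_Suc_subset by blast

lemma int_pow_commute:
  assumes "x \<otimes> y = y \<otimes> x" "x \<in> carrier G" "y \<in> carrier G"
  shows "x [^] (n :: int) \<otimes> y = y \<otimes> x [^] n"
proof -
  have *: "x [^] m \<otimes> y = y \<otimes> x [^] m" for m :: nat
    using assms by (rule group_commutes_pow)
  have "inv (x [^] m) \<otimes> y = y \<otimes> inv (x [^] m)" for m :: nat
  proof -
    have c: "x [^] m \<in> carrier G" using assms(2) by simp
    have "x [^] m \<otimes> (y \<otimes> inv (x [^] m)) = x [^] m \<otimes> y \<otimes> inv (x [^] m)"
      using c assms(3) by (simp only: m_assoc inv_closed)
    also have "\<dots> = y"
      unfolding * using c assms(3) by (simp only: m_assoc inv_closed r_inv r_one)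
    finally have "y = x [^] m \<otimes> (y \<otimes> inv (x [^] m))" ..
    then show ?thesis using inv_solve_left'[of "y \<otimes> inv (x [^] m)" "x [^] m" y] c assms(3) by blast
  qed
  note inv_comm = this
  show ?thesis
  proof (cases "n < 0")
    case True
    then show ?thesis unfolding int_pow_def2[where a = x and z = n] using inv_comm[of "nat (- n)"] by (simp only: if_True)
  next
    case False
    then show ?thesis unfolding int_pow_def2[where a = x and z = n] using *[of "nat n"] by (simp only: if_False)
  qed
qed

text \<open>The last nontrivial term of the lower central series is central, since its commutators
  lie in the trivial term that follows.\<close>

lemma nilpotent_nontrivial_center:
  assumes "nilpotent_group G" "carrier G \<noteq> {\<one>}"
  obtains S where "S \<in> carrier G" "S \<noteq> \<one>" "\<And>y. y \<in> carrier G \<Longrightarrow> S \<otimes> y = y \<otimes> S"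
proof -
  define n where "n = (LEAST n. lower_central_series G n = {\<one>})"
  have n: "lower_central_series G n = {\<one>}"
    using assms(1) unfolding nilpotent_group_def n_def by (elim conjE) (rule LeastI_ex)
  with assms(2) have "n \<noteq> 0" by (metis lower_central_series.simps(1))
  then obtain m where m: "n = Suc m" using not0_implies_Suc by blast
  then have "m < (LEAST n. lower_central_series G n = {\<one>})" unfolding n_def by simp
  then have "lower_central_series G m \<noteq> {\<one>}" by (rule not_less_Least)
  moreover have "\<one> \<in> lower_central_series G m" using subgroup_lower_central_series subgroup.one_closed by blast
  ultimately obtain S where S: "S \<in> lower_central_series G m" "S \<noteq> \<one>" by blast
  have Sc: "S \<in> carrier G" using S lower_central_series_subset_carrier by blast
  have "S \<otimes> y = y \<otimes> S" if y: "y \<in> carrier G" for y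
  proof -
    have "S \<otimes> y \<otimes> inv S \<otimes> inv y = \<one>" using lower_central_series_commutator[OF S(1) y] n unfolding m by blast
    then have "S \<otimes> y \<otimes> inv (y \<otimes> S) = \<one>" using Sc y by (simp add: inv_mult_group m_assoc)
    then show ?thesis using inv_solve_right'[of \<one> "S \<otimes> y" "y \<otimes> S"] Sc y by simp
  qed
  then show ?thesis using that S(2) Sc by blast
qed

end

text \<open>
  A commutator lies one step of the lower central series beyond each of its entries. Since the
  index grows only logarithmically, this suffices for the level of a commutator to be the sum of
  the levels of its entries.
\<close>

definition log_index :: "nat \<Rightarrow> nat \<Rightarrow> nat" where
  "log_index E s = (LEAST i. s \<le> E * 2 ^ i)"

lemma log_index_le_iff:
  assumes "E > 0"
  shows "log_index E s \<le> i \<longleftrightarrow> s \<le> E * 2 ^ i"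
proof
  have "s \<le> E * 2 ^ s" using less_exp[of s] assms by (metis less_imp_le mult_le_mono1 mult_1 le_trans Suc_leI One_nat_def)
  then have "s \<le> E * 2 ^ log_index E s" unfolding log_index_def by (rule LeastI)
  also assume "log_index E s \<le> i"
  then have "E * 2 ^ log_index E s \<le> E * 2 ^ i" by simp
  finally show "s \<le> E * 2 ^ i" .
qed (simp add: log_index_def Least_le)

lemma log_index_add_le:
  assumes "E > 0"
  shows "log_index E (i + j) \<le> Suc (max (log_index E i) (log_index E j))"
proof -
  let ?m = "max (log_index E i) (log_index E j)"
  have "i \<le> E * 2 ^ ?m" "j \<le> E * 2 ^ ?m"
    using log_index_le_iff[OF assms, of i ?m] log_index_le_iff[OF assms, of j ?m] by auto
  then show ?thesis unfolding log_index_le_iff[OF assms] by simp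
qed

lemma log_index_mono:
  assumes "E > 0" "i \<le> j" shows "log_index E i \<le> log_index E j"
  using assms log_index_le_iff[OF assms(1)] by (meson le_trans order_refl)

section \<open>The action of individual group elements\<close>

context topological_dynamical_system
begin

lemma action_continuous:
  assumes "g \<in> carrier G" shows "continuous_map mtopology mtopology (\<phi> g)"
proof -
  have "continuous_map mtopology (prod_topology TG mtopology) (\<lambda>x. (g, x))"
    using assms topspace_group by (intro continuous_map_pairedI) auto
  from continuous_map_compose[OF this continuous_action] show ?thesis by (simp add: o_def)
qed

lemma action_one: "x \<in> M \<Longrightarrow> \<phi> \<one> x = x"
  using id_eq_one by (metis restrict_apply')

lemma action_closed: "g \<in> carrier G \<Longrightarrow> x \<in> M \<Longrightarrow> \<phi> g x \<in> M"
  using surj_prop by blast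

lemma int_system_generated_action:
  assumes "S \<in> carrier G" shows "int_system mtopology (generated_action G \<phi> S)"
proof
  fix n show "continuous_map mtopology mtopology (generated_action G \<phi> S n)"
    using action_continuous[of "S [^] n"] assms by (simp add: generated_action_def[abs_def])
next
  fix x assume "x \<in> topspace mtopology"
  then show "generated_action G \<phi> S 0 x = x" by (simp add: generated_action_def action_one)
next
  fix x m n assume "x \<in> topspace mtopology"
  then show "generated_action G \<phi> S (m + n) x = generated_action G \<phi> S m (generated_action G \<phi> S n x)"
    using assms composition_rule[of x "S [^] m" "S [^] n"] by (simp add: generated_action_def int_pow_mult)
qed

end

text \<open>The hypotheses of the theorem with the degenerate cases of a trivial group or fewer than
  two points excluded; \<open>theorem1p1\<close> treats those separately.\<close>

locale mixing_nilpotent_system = topological_dynamical_system M dX G TG \<phi>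
  for M :: "'x set" and dX :: "'x \<Rightarrow> 'x \<Rightarrow> real"
    and G :: "('g, 'm) monoid_scheme" (structure) and TG :: "'g topology"
    and \<phi> :: "'g \<Rightarrow> 'x \<Rightarrow> 'x" +
  assumes nilpotent: "nilpotent_group G"
    and mixing: "S \<in> carrier G \<Longrightarrow> S \<noteq> \<one> \<Longrightarrow>
      weakly_mixing_system mtopology integer_group (generated_action G \<phi> S)"
    and minimal: "S \<in> carrier G \<Longrightarrow> S \<noteq> \<one> \<Longrightarrow>
      minimal_system mtopology integer_group (generated_action G \<phi> S)"
    and nontrivial_group: "carrier G \<noteq> {\<one>}"
    and two_points: "\<exists>x\<in>M. \<exists>y\<in>M. x \<noteq> y"
begin

text \<open>A finite orbit is closed and invariant, hence all of \<open>M\<close>. Then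
  \<open>M\<close> is finite and discrete, so the diagonal is open, closed and invariant, and weak
  mixing forces it to be all of \<open>M \<times> M\<close>.\<close>

lemma infinite_orbit:
  assumes S: "S \<in> carrier G" "S \<noteq> \<one>" and x: "x \<in> M"
  shows "infinite (range (\<lambda>n. generated_action G \<phi> S n x))"
proof
  let ?\<alpha> = "generated_action G \<phi> S"
  interpret \<alpha>: int_system mtopology ?\<alpha> using int_system_generated_action S(1) .
  assume fin: "finite (range (\<lambda>n. ?\<alpha> n x))"
  have "range (\<lambda>n. ?\<alpha> n x) \<subseteq> M" using \<alpha>.closed x by auto
  then have "closedin mtopology (range (\<lambda>n. ?\<alpha> n x))"
    using fin by (simp add: closedin_Hausdorff_finite Hausdorff_space_mtopology)
  moreover have "invariant_set integer_group ?\<alpha> (range (\<lambda>n. ?\<alpha> n x))"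
    unfolding invariant_set_def using \<alpha>.add x by (auto simp flip: \<alpha>.add)
  ultimately have "range (\<lambda>n. ?\<alpha> n x) = M"
    using minimal[OF S] unfolding minimal_system_def by auto
  with fin have finM: "finite M" by simp
  let ?P = "prod_topology mtopology mtopology" and ?D = "(\<lambda>x. (x, x)) ` M"
  have closed: "closedin ?P A" if "A \<subseteq> M \<times> M" for A
    using that finM by (intro closedin_Hausdorff_finite)
      (auto simp: Hausdorff_space_prod_topology Hausdorff_space_mtopology intro: finite_subset)
  have "openin ?P ?D" using closed[of "M \<times> M - ?D"] unfolding openin_closedin_eq by auto
  moreover have "?D \<noteq> {}" using x by blast
  moreover have "invariant_set integer_group (\<lambda>n (x, y). (?\<alpha> n x, ?\<alpha> n y)) ?D"
    unfolding invariant_set_def using \<alpha>.closed by auto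
  ultimately have "?P closure_of ?D = M \<times> M"
    using mixing[OF S] unfolding weakly_mixing_system_def transitive_system_def by auto
  moreover have "?P closure_of ?D = ?D" using closed[of ?D] by (intro closure_of_closedin) auto
  ultimately show False using two_points by blast
qed

definition perm_of :: "'g \<Rightarrow> 'x bijection" where
  "perm_of g = Abs_bijection (\<lambda>x. if x \<in> M then \<phi> g x else x)"

lemma Rep_perm_of:
  assumes "g \<in> carrier G"
  shows "Rep_bijection (perm_of g) = (\<lambda>x. if x \<in> M then \<phi> g x else x)"
proof -
  have cancel: "\<phi> h (\<phi> (inv h) x) = x" if "h \<in> carrier G" "x \<in> M" for h x
    using composition_rule[OF that(2,1), of "inv h"] that by (simp add: action_one)
  have "bij (\<lambda>x. if x \<in> M then \<phi> g x else x)"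
    by (rule o_bij[of "\<lambda>x. if x \<in> M then \<phi> (inv g) x else x"])
      (use cancel[of g] cancel[of "inv g"] assms action_closed in \<open>auto simp: fun_eq_iff\<close>)
  then show ?thesis unfolding perm_of_def by (simp add: Abs_bijection_inverse)
qed

lemma perm_of_apply: "g \<in> carrier G \<Longrightarrow> x \<in> M \<Longrightarrow> Rep_bijection (perm_of g) x = \<phi> g x"
  by (simp add: Rep_perm_of)

lemma perm_of_mult:
  assumes "g \<in> carrier G" "h \<in> carrier G"
  shows "perm_of (g \<otimes> h) = perm_of g + perm_of h"
  unfolding Rep_bijection_inject[symmetric] plus_bijection.rep_eq
  using assms by (auto simp: Rep_perm_of fun_eq_iff composition_rule action_closed)

lemma perm_of_one: "perm_of \<one> = 0"
proof -
  have "perm_of \<one> + perm_of \<one> = perm_of \<one> + 0" by (simp flip: perm_of_mult)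
  then show ?thesis by (simp only: add_left_cancel)
qed

lemma perm_of_inv: "g \<in> carrier G \<Longrightarrow> perm_of (inv g) = - perm_of g"
  using perm_of_mult[of "inv g" g] perm_of_one by (simp add: eq_neg_iff_add_eq_0)

text \<open>The action is faithful: the powers of an element acting trivially would have one-point
  orbits, contrary to \<open>infinite_orbit\<close>.\<close>

lemma perm_of_eq_zero:
  assumes "g \<in> carrier G" "perm_of g = 0" shows "g = \<one>"
proof (rule ccontr)
  assume "g \<noteq> \<one>"
  obtain x where x: "x \<in> M" using two_points by blast
  have nat: "perm_of (g [^] n) = 0" for n :: nat
  proof (induction n)
    case 0
    then show ?case by (simp add: perm_of_one)
  next
    case (Suc n)
    then show ?case using assms perm_of_mult[of "g [^] n" g] by simp
  qed
  have int: "perm_of (g [^] n) = 0" for n :: int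
  proof (cases "n < 0")
    case True
    have "perm_of (inv (g [^] nat (- n))) = 0"
      using assms(1) nat[of "nat (- n)"] perm_of_inv[of "g [^] nat (- n)"] by simp
    then show ?thesis unfolding int_pow_def2[where a = g and z = n] using True by (simp only: if_True)
  next
    case False
    then show ?thesis unfolding int_pow_def2[where a = g and z = n] using nat[of "nat n"] by (simp only: if_False)
  qed
  have "generated_action G \<phi> g n x = x" for n
    using perm_of_apply[of "g [^] n" x] assms(1) x int[of n]
    by (simp add: generated_action_def zero_bijection.rep_eq)
  then show False using infinite_orbit[OF assms(1) \<open>g \<noteq> \<one>\<close> x] by simp
qed

lemma perm_of_inj:
  assumes "g \<in> carrier G" "h \<in> carrier G" "perm_of g = perm_of h" shows "g = h"
proof -
  have "perm_of (g \<otimes> inv h) = 0" using assms by (simp add: perm_of_mult perm_of_inv)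
  then have "g \<otimes> inv h = \<one>" using assms perm_of_eq_zero by simp
  then show ?thesis using assms by (metis inv_equality inv_inv inv_closed)
qed

text \<open>A nontrivial torsion element would have finite orbits.\<close>

lemma power_eq_one:
  assumes "S \<in> carrier G" "m > 0" "S [^] (m :: nat) = \<one>"
  shows "S = \<one>"
proof (rule ccontr)
  assume "S \<noteq> \<one>"
  obtain x where x: "x \<in> M" using two_points by blast
  have "S [^] n = S [^] (n mod int m)" for n :: int
  proof -
    have "S [^] n = S [^] (int m * (n div int m) + n mod int m)" by simp
    also have "\<dots> = (S [^] int m) [^] (n div int m) \<otimes> S [^] (n mod int m)"
      using assms(1) by (simp only: int_pow_mult int_pow_pow)
    finally show ?thesis using assms by (simp add: int_pow_int)
  qed
  then have "range (\<lambda>n. generated_action G \<phi> S n x) \<subseteq> (\<lambda>n. generated_action G \<phi> S n x) ` {0..<int m}"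
    using assms(2) unfolding generated_action_def
    by (auto intro!: image_eqI[where x = "n mod int m" for n])
  then show False using infinite_orbit[OF assms(1) \<open>S \<noteq> \<one>\<close> x] finite_subset by blast
qed

text \<open>The whole group up to level \<open>E\<close>, the first commutator term up to
  \<open>2 * E\<close>, the next one up to \<open>4 * E\<close>, and so on.\<close>

definition filtration :: "nat \<Rightarrow> nat \<Rightarrow> 'x bijection set" where
  "filtration E s = perm_of ` lower_central_series G (log_index E s)"

lemma filtration_le: "s \<le> E \<Longrightarrow> E > 0 \<Longrightarrow> filtration E s = perm_of ` carrier G"
proof -
  assume "s \<le> E" "E > 0"
  then have "log_index E s = 0" using log_index_le_iff[of E s 0] by simp
  then show ?thesis by (simp add: filtration_def)
qed

lemma perm_of_int_pow_additive: "S \<in> carrier G \<Longrightarrow> additive_seq (\<lambda>n. perm_of (S [^] (n :: int)))"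
  unfolding additive_seq_def by (simp add: int_pow_mult[symmetric] flip: perm_of_mult)

lemma perm_of_nat_pow: "g \<in> carrier G \<Longrightarrow> perm_of (g [^] (m :: nat)) = ((+) (perm_of g) ^^ m) 0"
proof (induction m)
  case (Suc m)
  then show ?case using nat_pow_Suc2[of g m] by (simp add: perm_of_mult)
qed (simp add: perm_of_one)

lemma filtered_action_perm:
  assumes E: "E > 0"
  shows "\<exists>N. filtered_action (filtration E) N mtopology Rep_bijection"
proof -
  let ?lcs = "lower_central_series G"
  obtain n0 where n0: "?lcs n0 = {\<one>}" using nilpotent unfolding nilpotent_group_def by (elim conjE exE)
  \<comment> \<open>Just past \<open>E * 2 ^ n0\<close>, so its logarithmic index exceeds
    \<open>n0\<close> and the level is trivial.\<close>
  let ?N = "Suc (E * 2 ^ n0)"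
  have carrier: "x \<in> carrier G" if "x \<in> ?lcs n" for x n
    using that lower_central_series_subset_carrier by blast
  have L0: "filtration E 0 = perm_of ` carrier G" using filtration_le[of 0 E] E by simp
  have "filtered_action (filtration E) ?N mtopology Rep_bijection"
  proof
    fix s
    have sg: "subgroup (?lcs n) G" for n by (rule subgroup_lower_central_series)
    show "0 \<in> filtration E s" unfolding filtration_def perm_of_one[symmetric]
      using subgroup.one_closed[OF sg] by blast
    show "x + y \<in> filtration E s" if "x \<in> filtration E s" "y \<in> filtration E s" for x y
      using that subgroup.m_closed[OF sg] unfolding filtration_def
      by (auto simp: carrier simp flip: perm_of_mult)
    show "- x \<in> filtration E s" if "x \<in> filtration E s" for x
      using that subgroup.m_inv_closed[OF sg] unfolding filtration_def
      by (auto simp: carrier simp flip: perm_of_inv)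
    show "filtration E (Suc s) \<subseteq> filtration E s" unfolding filtration_def
      using lower_central_series_antimono[OF log_index_mono[OF E, of s "Suc s"]] by auto
    show "x + y - x - y \<in> filtration E (i + j)" if xy: "x \<in> filtration E i" "y \<in> filtration E j" for x y i j
    proof -
      define a b where "a = log_index E i" and "b = log_index E j"
      obtain g h where gh: "g \<in> ?lcs a" "x = perm_of g" "h \<in> ?lcs b" "y = perm_of h"
        using xy unfolding filtration_def a_def b_def by blast
      have c: "g \<in> carrier G" "h \<in> carrier G" using gh carrier by auto
      have "g \<otimes> h \<otimes> inv g \<otimes> inv h \<in> ?lcs (Suc a)"
        using lower_central_series_commutator gh(1) c(2) .
      \<comment> \<open>The inverse of the commutator of \<open>h\<close> and \<open>g\<close> is
        that of \<open>g\<close> and \<open>h\<close>, so the latter also lies beyond the index of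
        \<open>h\<close>.\<close>
      moreover have "inv (h \<otimes> g \<otimes> inv h \<otimes> inv g) \<in> ?lcs (Suc b)"
        using lower_central_series_commutator[OF gh(3) c(1)] subgroup.m_inv_closed[OF sg] by blast
      then have "g \<otimes> h \<otimes> inv g \<otimes> inv h \<in> ?lcs (Suc b)"
        using c by (simp add: inv_mult_group m_assoc)
      ultimately have "g \<otimes> h \<otimes> inv g \<otimes> inv h \<in> ?lcs (Suc (max a b))"
        by (simp add: max_def)
      then have "g \<otimes> h \<otimes> inv g \<otimes> inv h \<in> ?lcs (log_index E (i + j))"
        using lower_central_series_antimono[OF log_index_add_le[OF E, of i j]] unfolding a_def b_def by blast
      moreover have "x + y - x - y = perm_of (g \<otimes> h \<otimes> inv g \<otimes> inv h)"
        using c by (simp add: gh perm_of_mult perm_of_inv)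
      ultimately show ?thesis unfolding filtration_def by blast
    qed
    have "n0 \<le> log_index E ?N" using log_index_le_iff[OF E, of ?N n0] by simp
    then have "?lcs (log_index E ?N) = {\<one>}"
      using lower_central_series_antimono[of n0 "log_index E ?N"] n0 subgroup.one_closed[OF sg] by blast
    then show "filtration E ?N = {0}" unfolding filtration_def by (simp add: perm_of_one)
    show "x = 0" if x: "x \<in> filtration E 0" "0 < m" "((+) x ^^ m) 0 = 0" for x m
    proof -
      obtain g where g: "g \<in> carrier G" "x = perm_of g" using \<open>x \<in> filtration E 0\<close> unfolding L0 by blast
      have "perm_of (g [^] m) = 0" using x(3) g by (simp add: perm_of_nat_pow)
      then have "g = \<one>" using g(1) perm_of_eq_zero power_eq_one \<open>0 < m\<close> by (metis nat_pow_closed)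
      then show ?thesis using g perm_of_one by simp
    qed
    show "Rep_bijection (a + b) x = Rep_bijection a (Rep_bijection b x)" for a b :: "'x bijection" and x
      by (simp add: plus_bijection.rep_eq)
    show "Rep_bijection 0 x = x" for x :: 'x by (simp add: zero_bijection.rep_eq)
    show "continuous_map mtopology mtopology (Rep_bijection a)" if a: "a \<in> filtration E 0" for a
    proof -
      obtain g where g: "g \<in> carrier G" "a = perm_of g" using a unfolding L0 by blast
      show ?thesis
        by (rule continuous_map_eq[OF action_continuous[OF g(1)]]) (simp add: g perm_of_apply)
    qed
    show "\<exists>C. finite C \<and> C \<subseteq> filtration E 0 \<and> (\<forall>c\<in>C. \<forall>a\<in>filtration E 0. c + a = a + c) \<and>
        topspace mtopology \<subseteq> (\<Union>c\<in>C. Rep_bijection c ` U)"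
      if U: "openin mtopology U" "U \<noteq> {}" for U
    proof -
      obtain S where S: "S \<in> carrier G" "S \<noteq> \<one>" "\<And>y. y \<in> carrier G \<Longrightarrow> S \<otimes> y = y \<otimes> S"
        using nilpotent_nontrivial_center[OF nilpotent nontrivial_group] by blast
      let ?\<alpha> = "generated_action G \<phi> S"
      interpret \<alpha>: int_system mtopology ?\<alpha> using int_system_generated_action S(1) .
      obtain F where F: "finite F" "topspace mtopology \<subseteq> (\<Union>j\<in>F. \<alpha>.pre j U)"
        using \<alpha>.minimal_cover[OF compact_phase_space minimal[OF S(1,2)] U] by blast
      \<comment> \<open>The set \<open>\<alpha>.pre j U\<close> is the image of \<open>U\<close>
        under the power \<open>- j\<close> of the central element \<open>S\<close>.\<close>
      define C where "C = (\<lambda>j. perm_of (S [^] (- j))) ` F"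
      have "S [^] j \<otimes> y = y \<otimes> S [^] j" if "y \<in> carrier G" for y and j :: int
        using int_pow_commute[OF S(3)[OF that] S(1) that] .
      then have "perm_of (S [^] (- j)) + perm_of y = perm_of y + perm_of (S [^] (- j))"
        if "y \<in> carrier G" for y and j :: int
        using S(1) that by (simp flip: perm_of_mult)
      then have central: "\<forall>c\<in>C. \<forall>a\<in>filtration E 0. c + a = a + c" unfolding L0 C_def by blast
      have cover: "x \<in> (\<Union>c\<in>C. Rep_bijection c ` U)" if x: "x \<in> topspace mtopology" for x
      proof -
        obtain j where j: "j \<in> F" "?\<alpha> j x \<in> U" using F(2) x by (auto simp: \<alpha>.pre_def)
        have "x = Rep_bijection (perm_of (S [^] (- j))) (?\<alpha> j x)"
          using \<alpha>.cancel(2)[OF x, of j] \<alpha>.closed[OF x, of j] S(1)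
          by (simp add: perm_of_apply generated_action_def)
        then show ?thesis using j unfolding C_def by blast
      qed
      have sub: "C \<subseteq> filtration E 0" unfolding L0 C_def using S(1) by auto
      have fin: "finite C" using F(1) by (simp add: C_def)
      show ?thesis by (rule exI[of _ C], intro conjI fin sub central subsetI) (rule cover)
    qed
    show "\<exists>k. k \<notin> F \<and> (\<forall>g\<in>A. \<exists>x\<in>W g. Rep_bijection (g k) x \<in> V g)"
      if fin: "finite A" "finite F"
        and A: "\<And>g. g \<in> A \<Longrightarrow> additive_seq g \<and> g \<noteq> 0 \<and> range g \<subseteq> filtration E 0"
        and UV: "\<And>g. g \<in> A \<Longrightarrow> openin mtopology (W g) \<and> W g \<noteq> {} \<and> openin mtopology (V g) \<and> V g \<noteq> {}"
      for A F W V
    proof -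
      have "thickly_syndetic {k. \<exists>x\<in>W g. Rep_bijection (g k) x \<in> V g}" if g: "g \<in> A" for g
      proof -
        \<comment> \<open>An additive sequence is determined by its value at 1, so \<open>g\<close>
          runs through the powers of a single \<open>S\<close>, and its return times are those of
          the system generated by \<open>S\<close>.\<close>
        obtain S where S: "S \<in> carrier G" "g 1 = perm_of S" using A[OF g] unfolding L0 by blast
        have geq: "g = (\<lambda>n. perm_of (S [^] n))"
          using A[OF g] S by (intro additive_seq_unique perm_of_int_pow_additive) auto
        have "S \<noteq> \<one>"
        proof
          assume "S = \<one>"
          then have "g = 0" using geq by (simp add: perm_of_one fun_eq_iff)
          then show False using A[OF g] by blast
        qed
        let ?\<alpha> = "generated_action G \<phi> S"
        interpret \<alpha>: int_system mtopology ?\<alpha> using int_system_generated_action S(1) .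
        have "{k. \<exists>x\<in>W g. Rep_bijection (g k) x \<in> V g} = \<alpha>.hits (W g) (V g)"
        proof -
          have "Rep_bijection (g k) x = ?\<alpha> k x" if "x \<in> W g" for x k
          proof -
            have "x \<in> M" using that UV[OF g] openin_subset[of mtopology "W g"] by auto
            then show ?thesis unfolding geq using S(1) by (simp add: perm_of_apply generated_action_def)
          qed
          then show ?thesis unfolding \<alpha>.hits_def by auto
        qed
        moreover have "thickly_syndetic (\<alpha>.hits (W g) (V g))"
          using \<alpha>.thickly_syndetic_hits[OF compact_phase_space minimal mixing] S(1) \<open>S \<noteq> \<one>\<close> UV[OF g] by blast
        ultimately show ?thesis by simp
      qed
      then have "thickly_syndetic (\<Inter>g\<in>A. {k. \<exists>x\<in>W g. Rep_bijection (g k) x \<in> V g})"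
        using fin(1) by (rule thickly_syndetic_INT[rotated])
      then obtain k where "k \<in> (\<Inter>g\<in>A. {k. \<exists>x\<in>W g. Rep_bijection (g k) x \<in> V g})" "k \<notin> F"
        using fin(2) by (rule thickly_syndetic_not_subset_finite)
      then show ?thesis by blast
    qed
  qed
  then show ?thesis by blast
qed

end

section \<open>Generic points\<close>

context Metric_space
begin

text \<open>The balls of radius \<open>1 / (n + 1)\<close> around finite nets supplied by total
  boundedness.\<close>

lemma compact_countable_pi_base:
  assumes "compact_space mtopology"
  shows "\<exists>\<B>. countable \<B> \<and> (\<forall>B\<in>\<B>. openin mtopology B \<and> B \<noteq> {}) \<and>
    (\<forall>U. openin mtopology U \<and> U \<noteq> {} \<longrightarrow> (\<exists>B\<in>\<B>. B \<subseteq> U))"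
proof -
  have "mtotally_bounded M"
    using compactin_imp_mtotally_bounded assms unfolding compact_space_def by simp
  then have "\<forall>n. \<exists>K. finite K \<and> K \<subseteq> M \<and> M \<subseteq> (\<Union>x\<in>K. mball x (inverse (real (Suc n))))"
    unfolding mtotally_bounded_def by simp
  then obtain K where K: "\<And>n. finite (K n)" "\<And>n. K n \<subseteq> M"
      "\<And>n. M \<subseteq> (\<Union>x\<in>K n. mball x (inverse (real (Suc n))))"
    by metis
  define \<B> where "\<B> = (\<Union>n. (\<lambda>x. mball x (inverse (real (Suc n)))) ` K n)"
  have "countable \<B>" unfolding \<B>_def using K(1) by (auto intro: countable_finite)
  moreover have "openin mtopology B \<and> B \<noteq> {}" if "B \<in> \<B>" for B
  proof -
    obtain n x where "x \<in> K n" "B = mball x (inverse (real (Suc n)))" using \<open>B \<in> \<B>\<close> unfolding \<B>_def by blast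
    then show ?thesis using K(2)[of n] by (auto simp: mball_eq_empty)
  qed
  moreover have "\<exists>B\<in>\<B>. B \<subseteq> U" if U: "openin mtopology U" "U \<noteq> {}" for U
  proof -
    obtain y where y: "y \<in> U" using U by blast
    then have yM: "y \<in> M" using U openin_subset by fastforce
    obtain r where r: "r > 0" "mball y r \<subseteq> U" using U y unfolding openin_mtopology by blast
    obtain n where n: "inverse (real (Suc n)) < r / 2" using reals_Archimedean[of "r / 2"] r by auto
    obtain x where x: "x \<in> K n" "y \<in> mball x (inverse (real (Suc n)))" using K(3)[of n] yM by blast
    have "mball x (inverse (real (Suc n))) \<subseteq> mball y r"
    proof
      fix z assume z: "z \<in> mball x (inverse (real (Suc n)))"
      then have "d y z \<le> d y x + d x z" using x triangle[of y x z] by auto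
      then show "z \<in> mball y r" using z x n yM commute[of x y] by auto
    qed
    then have "mball x (inverse (real (Suc n))) \<subseteq> U" using r(2) by blast
    then show ?thesis unfolding \<B>_def using x(1) by blast
  qed
  ultimately show ?thesis by blast
qed

text \<open>For each choice of basic sets \<open>b\<close>, the points whose tuple enters the box of
  \<open>b\<close> at some time form an open set, dense by recurrence. There are countably many
  choices, so Baire's theorem applies to their intersection.\<close>

lemma generic_dense_tuples:
  fixes f :: "'i \<Rightarrow> int \<Rightarrow> 'a \<Rightarrow> 'a"
  assumes compact: "compact_space mtopology" and I: "finite I"
    and cont: "\<And>i n. i \<in> I \<Longrightarrow> continuous_map mtopology mtopology (f i n)"
    and recurrence: "\<And>U V. openin mtopology U \<Longrightarrow> U \<noteq> {} \<Longrightarrow>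
      (\<And>i. i \<in> I \<Longrightarrow> openin mtopology (V i) \<and> V i \<noteq> {}) \<Longrightarrow> \<exists>n. \<exists>z\<in>U. \<forall>i\<in>I. f i n z \<in> V i"
  shows "\<exists>X0. gdelta_in mtopology X0 \<and> mtopology closure_of X0 = topspace mtopology \<and>
    (\<forall>x\<in>X0. product_topology (\<lambda>_. mtopology) I closure_of range (\<lambda>n. \<lambda>i\<in>I. f i n x)
      = topspace (product_topology (\<lambda>_. mtopology) I))"
proof -
  obtain \<B> where "countable \<B>" and open_\<B>: "\<forall>B\<in>\<B>. openin mtopology B \<and> B \<noteq> {}"
    and base: "\<forall>U. openin mtopology U \<and> U \<noteq> {} \<longrightarrow> (\<exists>B\<in>\<B>. B \<subseteq> U)"
    using compact_countable_pi_base[OF compact] by (elim exE conjE)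
  \<comment> \<open>The factor \<open>M\<close> keeps the set inside the space when \<open>I\<close>
    is empty.\<close>
  define hit where "hit b = (\<Union>n. (\<Inter>i\<in>I. {x \<in> M. f i n x \<in> b i}) \<inter> M)" for b
  \<comment> \<open>Inserting \<open>M\<close> makes the family nonempty even if there are no basic
    sets.\<close>
  define \<G> where "\<G> = insert M (hit ` PiE I (\<lambda>_. \<B>))"
  have "countable \<G>" unfolding \<G>_def using \<open>countable \<B>\<close> I by (simp add: countable_PiE)
  have hit: "openin mtopology (hit b)" "mtopology closure_of (hit b) = M" if b: "b \<in> PiE I (\<lambda>_. \<B>)" for b
  proof -
    have bi: "openin mtopology (b i) \<and> b i \<noteq> {}" if "i \<in> I" for i using PiE_mem[OF b that] open_\<B> by blast
    have "openin mtopology {x \<in> M. f i n x \<in> b i}" if "i \<in> I" for i n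
      using openin_continuous_map_preimage[OF cont[OF that]] bi[OF that] by simp
    then have "openin mtopology ((\<Inter>i\<in>I. {x \<in> M. f i n x \<in> b i}) \<inter> topspace mtopology)" for n
      using I by (intro openin_INT)
    then show "openin mtopology (hit b)" unfolding hit_def by (intro openin_Union) auto
    have "hit b \<inter> U \<noteq> {}" if U: "openin mtopology U" "U \<noteq> {}" for U
    proof -
      obtain n z where z: "z \<in> U" "\<And>i. i \<in> I \<Longrightarrow> f i n z \<in> b i" using recurrence[OF U, of b] bi by blast
      moreover have "z \<in> M" using z(1) openin_subset[OF U(1)] by auto
      ultimately show ?thesis unfolding hit_def by blast
    qed
    then show "mtopology closure_of (hit b) = M"
      using dense_intersects_open[of mtopology "hit b"] by simp
  qed
  have \<G>: "openin mtopology T \<and> mtopology closure_of T = M" if "T \<in> \<G>" for T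
    using that hit closure_of_topspace[of mtopology] unfolding \<G>_def by auto
  have "gdelta_in mtopology (\<Inter>\<G>)"
    using \<open>countable \<G>\<close> \<G> by (intro gdelta_in_Inter open_imp_gdelta_in) (auto simp: \<G>_def)
  moreover have "mtopology closure_of \<Inter>\<G> = topspace mtopology"
    using metric_Baire_category[OF compact_space_imp_mcomplete[OF compact] \<open>countable \<G>\<close> \<G>] by simp
  moreover have "product_topology (\<lambda>_. mtopology) I closure_of range (\<lambda>n. \<lambda>i\<in>I. f i n x)
      = topspace (product_topology (\<lambda>_. mtopology) I)" if x: "x \<in> \<Inter>\<G>" for x
    unfolding dense_intersects_open
  proof (intro allI impI, elim conjE)
    fix W assume W: "openin (product_topology (\<lambda>_. mtopology) I) W" "W \<noteq> {}"
    then obtain y where y: "y \<in> W" by blast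
    have "\<exists>U. finite {i \<in> I. U i \<noteq> topspace mtopology} \<and> (\<forall>i\<in>I. openin mtopology (U i)) \<and>
        y \<in> PiE I U \<and> PiE I U \<subseteq> W"
      using W(1) unfolding openin_product_topology_alt by (rule bspec[OF _ y])
    then obtain U where UI: "\<forall>i\<in>I. openin mtopology (U i)" and U: "y \<in> PiE I U" "PiE I U \<subseteq> W"
      by (elim exE conjE)
    have "\<exists>B\<in>\<B>. B \<subseteq> U i" if "i \<in> I" for i
      using base UI that PiE_mem[OF U(1) that] by blast
    then obtain b where b: "\<forall>i\<in>I. b i \<in> \<B> \<and> b i \<subseteq> U i"
      using bchoice[of I "\<lambda>i B. B \<in> \<B> \<and> B \<subseteq> U i"] by blast
    then have "restrict b I \<in> PiE I (\<lambda>_. \<B>)" by auto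
    then have "x \<in> hit (restrict b I)" using x unfolding \<G>_def by blast
    then obtain n where n: "\<And>i. i \<in> I \<Longrightarrow> f i n x \<in> b i" unfolding hit_def by auto
    then have "(\<lambda>i\<in>I. f i n x) \<in> PiE I U" using b by auto
    then show "range (\<lambda>n. \<lambda>i\<in>I. f i n x) \<inter> W \<noteq> {}" using U(2) by blast
  qed
  ultimately show ?thesis by blast
qed

end

section \<open>From polynomial words to recurrence and the theorem\<close>

lemma (in group) poly_word_closed:
  assumes "\<And>j. j \<in> {1..d} \<Longrightarrow> T j \<in> carrier G"
  shows "poly_word G d T q n \<in> carrier G"
proof -
  have "foldr (\<lambda>j y. (T j [^] int_value (q j) n) \<otimes> y) js \<one> \<in> carrier G"
    if "set js \<subseteq> {1..d}" for js using that assms by (induction js) auto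
  then show ?thesis unfolding poly_word_def by (simp add: atLeastLessThanSuc_atLeastAtMost del: upt_Suc)
qed

context mixing_nilpotent_system
begin

text \<open>The words become polynomial sequences of bijections that vanish at 0. Faithfulness turns
  the two nontriviality assumptions into \<open>g i \<noteq> 0\<close> and injectivity of
  \<open>g\<close> on \<open>I\<close>.\<close>

theorem poly_word_recurrence:
  assumes T: "\<And>j. j \<in> {1..d} \<Longrightarrow> T j \<in> carrier G"
    and p: "\<And>i j. i \<in> I \<Longrightarrow> j \<in> {1..d} \<Longrightarrow> p i j \<in> integral_polys0"
    and I: "finite I"
    and nontriv: "\<And>i. i \<in> I \<Longrightarrow> depends_nontrivially (poly_word G d T (p i))"
    and nontriv_diff: "\<And>i j. i \<in> I \<Longrightarrow> j \<in> I \<Longrightarrow> i \<noteq> j \<Longrightarrow>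
      depends_nontrivially (\<lambda>n. poly_word G d T (p i) n \<otimes> inv (poly_word G d T (p j) n))"
    and U: "openin mtopology U" "U \<noteq> {}"
    and V: "\<And>i. i \<in> I \<Longrightarrow> openin mtopology (V i) \<and> V i \<noteq> {}"
  shows "\<exists>n. \<exists>z\<in>U. \<forall>i\<in>I. \<phi> (poly_word G d T (p i) n) z \<in> V i"
proof -
  \<comment> \<open>The successor leaves room for one level: every exponent degree is at most
    \<open>E - 1\<close>, so the words have level 1.\<close>
  define E where "E = Suc (\<Sum>i\<in>I. \<Sum>j\<in>{1..d}. degree (p i j))"
  have E: "degree (p i j) + 1 \<le> E" if "i \<in> I" "j \<in> {1..d}" for i j
  proof -
    have "degree (p i j) \<le> (\<Sum>j\<in>{1..d}. degree (p i j))" using that by (intro member_le_sum) auto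
    also have "\<dots> \<le> (\<Sum>i\<in>I. \<Sum>j\<in>{1..d}. degree (p i j))" using that I
      by (intro member_le_sum[where f = "\<lambda>i. \<Sum>j\<in>{1..d}. degree (p i j)"]) auto
    finally show ?thesis by (simp add: E_def)
  qed
  have "E > 0" by (simp add: E_def)
  then obtain N where "filtered_action (filtration E) N mtopology Rep_bijection"
    using filtered_action_perm by blast
  then interpret FA: filtered_action "filtration E" E N mtopology Rep_bijection .
  define w where "w i n = poly_word G d T (p i) n" for i n
  define g where "g i n = perm_of (w i n)" for i n
  have wc: "w i n \<in> carrier G" for i n unfolding w_def using T by (rule poly_word_closed)
  have poly_foldr: "FA.poly_seq 1 (\<lambda>n. perm_of (foldr (\<lambda>j y. (T j [^] int_value (p i j) n) \<otimes> y) js \<one>))"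
    if i: "i \<in> I" and js: "set js \<subseteq> {1..d}" for i js
    using js
  proof (induction js)
    case Nil
    have "FA.poly_seq 1 (\<lambda>_. 0)" by (rule FA.const[OF FA.zero_L])
    then show ?case by (simp add: perm_of_one)
  next
    case (Cons j js)
    then have j: "j \<in> {1..d}" and js: "set js \<subseteq> {1..d}" by auto
    have c: "foldr (\<lambda>j y. (T j [^] int_value (p i j) n) \<otimes> y) js \<one> \<in> carrier G" for n
      using js T by (induction js) auto
    have "FA.poly_seq 1 (\<lambda>n. perm_of (T j [^] int_value (p i j) n))"
    proof (rule FA.hom[where \<theta> = "\<lambda>n. perm_of (T j [^] n)"])
      show "additive_seq (\<lambda>n::int. perm_of (T j [^] n))" using T[OF j] by (rule perm_of_int_pow_additive)
      show "range (\<lambda>n::int. perm_of (T j [^] n)) \<subseteq> filtration E E"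
        using T[OF j] filtration_le[of E E] \<open>E > 0\<close> by auto
      show "diff_degree_le (degree (p i j)) (int_value (p i j))"
        using p[OF i j] by (rule diff_degree_le_int_value)
      show "degree (p i j) + 1 \<le> E" using E[OF i j] .
    qed
    from FA.add[OF this Cons.IH[OF js]] show ?case
      using T[OF j] c by (simp add: perm_of_mult plus_fun_def)
  qed
  have poly: "FA.poly_seq 1 (g i)" if "i \<in> I" for i
    using poly_foldr[OF that, of "[1..<Suc d]"] unfolding g_def[abs_def] w_def poly_word_def
    by (simp add: atLeastLessThanSuc_atLeastAtMost del: upt_Suc)
  have "int_value (p i j) 0 = 0" if "i \<in> I" "j \<in> {1..d}" for i j
    using p[OF that] by (simp add: integral_polys0_def int_value_def)
  then have "foldr (\<lambda>j y. (T j [^] int_value (p i j) 0) \<otimes> y) js \<one> = \<one>"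
    if "i \<in> I" "set js \<subseteq> {1..d}" for i js
    using that(2) by (induction js) (use that(1) in auto)
  then have "w i 0 = \<one>" if "i \<in> I" for i
    using that unfolding w_def poly_word_def by (simp add: atLeastLessThanSuc_atLeastAtMost del: upt_Suc)
  then have zero: "g i 0 = 0" if "i \<in> I" for i using that by (simp add: g_def perm_of_one)
  have nonzero: "g i \<noteq> 0" if i: "i \<in> I" for i
  proof
    assume "g i = 0"
    then have "w i n = \<one>" for n using perm_of_eq_zero[OF wc] by (simp add: g_def fun_eq_iff)
    then have "poly_word G d T (p i) constant_on UNIV" unfolding constant_on_def w_def by blast
    then show False using nontriv[OF i] unfolding depends_nontrivially_def by blast
  qed
  have inj: "inj_on g I"
  proof (rule inj_onI, rule ccontr)
    fix i j assume ij: "i \<in> I" "j \<in> I" "g i = g j" "i \<noteq> j"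
    have "w i n = w j n" for n using perm_of_inj[OF wc wc] fun_cong[OF ij(3), of n] by (simp add: g_def)
    then have "w i n \<otimes> inv (w j n) = \<one>" for n using wc by simp
    then have "(\<lambda>n. poly_word G d T (p i) n \<otimes> inv (poly_word G d T (p j) n)) constant_on UNIV"
      unfolding constant_on_def w_def by blast
    then show False using nontriv_diff[OF ij(1,2,4)] unfolding depends_nontrivially_def by blast
  qed
  \<comment> \<open>\<open>poly_seq_recurrence\<close> indexes targets by sequences; injectivity of
    \<open>g\<close> recovers the index \<open>i\<close>.\<close>
  have "\<exists>n. \<exists>z\<in>U. \<forall>h\<in>g ` I. Rep_bijection (h n) z \<in> V (inv_into I g h)"
  proof (rule FA.poly_seq_recurrence[OF _ _ U])
    show "finite (g ` I)" using I by simp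
    show "FA.poly_seq 1 h \<and> h 0 = 0 \<and> h \<noteq> 0" if h: "h \<in> g ` I" for h
    proof -
      obtain i where i: "i \<in> I" "h = g i" using h by (elim imageE)
      show ?thesis unfolding i(2) by (intro conjI poly zero nonzero i(1))
    qed
    show "openin mtopology (V (inv_into I g h)) \<and> V (inv_into I g h) \<noteq> {}" if "h \<in> g ` I" for h
      using V[OF inv_into_into[OF that]] .
  qed
  then obtain n z where z: "z \<in> U" "\<forall>h\<in>g ` I. Rep_bijection (h n) z \<in> V (inv_into I g h)"
    by (elim exE bexE)
  have zM: "z \<in> M" using z(1) openin_subset[OF U(1)] by auto
  have "\<phi> (w i n) z \<in> V i" if "i \<in> I" for i
  proof -
    have "Rep_bijection (g i n) z \<in> V (inv_into I g (g i))" using z(2) that by blast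
    then have "Rep_bijection (g i n) z \<in> V i" using inv_into_f_f[OF inj that] by simp
    then show ?thesis using perm_of_apply[OF wc zM] by (simp add: g_def)
  qed
  then show ?thesis using z(1) unfolding w_def by blast
qed

end

theorem theorem1p1:
  fixes M :: "'x set" and dX :: "'x \<Rightarrow> 'x \<Rightarrow> real"
    and G :: "('g, 'm) monoid_scheme" and TG :: "'g topology"
    and \<phi> :: "'g \<Rightarrow> 'x \<Rightarrow> 'x"
    and d k :: nat
    and T :: "nat \<Rightarrow> 'g"
    and p :: "nat \<Rightarrow> nat \<Rightarrow> rat poly"
    and g :: "nat \<Rightarrow> int \<Rightarrow> 'g"
    and X :: "'x topology"
  defines "X \<equiv> Metric_space.mtopology M dX"
    and "g \<equiv> (\<lambda>i. poly_word G d T (p i))"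
  assumes system: "topological_dynamical_system M dX G TG \<phi>"
    and nilpotent: "nilpotent_group G"
    and mixing: "\<And>S. S \<in> carrier G \<Longrightarrow> S \<noteq> \<one>\<^bsub>G\<^esub> \<Longrightarrow>
           weakly_mixing_system X integer_group (generated_action G \<phi> S)"
    and minimal: "\<And>S. S \<in> carrier G \<Longrightarrow> S \<noteq> \<one>\<^bsub>G\<^esub> \<Longrightarrow>
           minimal_system X integer_group (generated_action G \<phi> S)"
    and "d \<ge> 1" and "k \<ge> 1"
    and T: "\<And>j. j \<in> {1..d} \<Longrightarrow> T j \<in> carrier G"
    and p: "\<And>i j. i \<in> {1..k} \<Longrightarrow> j \<in> {1..d} \<Longrightarrow> p i j \<in> integral_polys0"
    and nontriv: "\<And>i. i \<in> {1..k} \<Longrightarrow> depends_nontrivially (g i)"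
    and nontriv_diff: "\<And>i j. i \<in> {1..k} \<Longrightarrow> j \<in> {1..k} \<Longrightarrow> i \<noteq> j \<Longrightarrow>
           depends_nontrivially (\<lambda>n. g i n \<otimes>\<^bsub>G\<^esub> inv\<^bsub>G\<^esub> (g j n))"
  shows "\<exists>X0. gdelta_in X X0 \<and> X closure_of X0 = topspace X \<and>
           (\<forall>x \<in> X0.
              product_topology (\<lambda>_. X) {1..k} closure_of
                range (\<lambda>n::int. \<lambda>i\<in>{1..k}. \<phi> (g i n) x)
              = topspace (product_topology (\<lambda>_. X) {1..k}))"
proof -
  interpret topological_dynamical_system M dX G TG \<phi> by (rule system)
  have gc: "g i n \<in> carrier G" for i n unfolding g_def using T by (rule poly_word_closed)
  show ?thesis unfolding X_def
  proof (rule generic_dense_tuples[OF compact_phase_space])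
    show "finite {1..k}" by simp
    show "continuous_map mtopology mtopology (\<phi> (g i n))" if "i \<in> {1..k}" for i n
      using gc by (rule action_continuous)
    fix U V assume U: "openin mtopology U" "U \<noteq> {}"
      and V: "\<And>i. i \<in> {1..k} \<Longrightarrow> openin mtopology (V i) \<and> V i \<noteq> {}"
    show "\<exists>n. \<exists>z\<in>U. \<forall>i\<in>{1..k}. \<phi> (g i n) z \<in> V i"
    proof (cases "\<exists>x\<in>M. \<exists>y\<in>M. x \<noteq> y")
      case True
      have "carrier G \<noteq> {\<one>\<^bsub>G\<^esub>}"
      proof
        assume "carrier G = {\<one>\<^bsub>G\<^esub>}"
        then have "g 1 n = \<one>\<^bsub>G\<^esub>" for n using gc[of 1 n] by simp
        then have "g 1 constant_on UNIV" unfolding constant_on_def by blast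
        then show False using nontriv[of 1] \<open>k \<ge> 1\<close> unfolding depends_nontrivially_def by simp
      qed
      then interpret mixing_nilpotent_system M dX G TG \<phi>
        using nilpotent mixing minimal True unfolding X_def by unfold_locales
      show ?thesis unfolding g_def
      proof (rule poly_word_recurrence[OF T _ _ _ _ U])
        show "p i j \<in> integral_polys0" if "i \<in> {1..k}" "j \<in> {1..d}" for i j using p that .
        show "finite {1..k}" by simp
        show "depends_nontrivially (poly_word G d T (p i))" if "i \<in> {1..k}" for i
          using nontriv[OF that] unfolding g_def .
        show "depends_nontrivially (\<lambda>n. poly_word G d T (p i) n \<otimes>\<^bsub>G\<^esub> inv\<^bsub>G\<^esub> (poly_word G d T (p j) n))"
          if "i \<in> {1..k}" "j \<in> {1..k}" "i \<noteq> j" for i j using nontriv_diff[OF that] unfolding g_def .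
        show "openin mtopology (V i) \<and> V i \<noteq> {}" if "i \<in> {1..k}" for i using V that .
      qed
    next
      case False
      \<comment> \<open>With at most one point, the single point lies in \<open>U\<close> and in
        every \<open>V i\<close>, and \<open>n = 0\<close> works.\<close>
      obtain z where z: "z \<in> U" "z \<in> M" using U openin_subset[OF U(1)] by auto
      have "\<phi> (g i 0) z \<in> V i" if i: "i \<in> {1..k}" for i
      proof -
        obtain v where v: "v \<in> V i" "v \<in> M"
          using V[OF i] openin_subset[of mtopology "V i"] by auto
        have "\<phi> (g i 0) z = v" using False v(2) action_closed[OF gc z(2)] by blast
        then show ?thesis using v(1) by simp
      qed
      then show ?thesis using z(1) by blast
    qed
  qed
qed

end
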